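(* Let $X$ be a proper $\mathrm{CAT}(0)$ space whose curtain model $X_D$ is unbounded, and let $G$ be a group acting on $X$ co-compactly. Then $G_X=G_{X_D}$, where $G_X$ is the coarse kernel of the action of $G$ on $X$ and $G_{X_D}$ is the coarse kernel of the induced action of $G$ on $X_D$.
   Context: All actions are by isometries. Coarse kernel: for $G$ acting on a metric space $(Z,d_Z)$, $G_Z := \{g\in G \mid \exists C>0 \text{ with } d_Z(g\cdot z,z)\le C\ \forall z\in Z\}$. Curtain model. Let $X$ be a $\mathrm{CAT}(0)$ space. For a geodesic $\alpha:I\to X$ ($I\subseteq\mathbb{R}$ a closed interval) with closest-point projection $\pi_\alpha$ onto $\alpha$, and $r$ with $[r-1/2,r+1/2]$ in the interior of $I$, the curtain dual to $\alpha$ at $r$ is $h=h_{\alpha,r}=\pi_\alpha^{-1}(\alpha[r-1/2,r+1/2])$. Its halfspaces are $h^-=\pi_\alpha^{-1}\alpha(I\cap(-\infty,r-1/2))$ and $h^+=\pi_\alpha^{-1}\alpha(I\cap(r+1/2,\infty))$. The curtain $h$ separates subsets $A,B\subseteq X$ if one lies in $h^-$ and the other in $h^+$. A set $\{h_i\}$ of curtains (indexed by consecutive integers) is a chain if $h_i$ separates $h_{i-1}$ from $h_{i+1}$ for all $i$; a chain separates $A$ from $B$ if each $h_i$ does. For $L\in\mathbb{N}$, $L\geq 1$, disjoint curtains $h,h'$ are $L$-separated if every chain all of whose members meet both $h$ and $h'$ has cardinality at most $L$. An $L$-chain is a chain of curtains in which each pair is $L$-separated. Set $d_L(x,x)=0$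 and, for $x\ne y$, $d_L(x,y)=1+\max\{|c| : c \text{ is an } L\text{-chain separating } x \text{ from } y\}$. Fix a sequence $\lambda_L\in(0,1)$ with $\sum_{L\ge1}\lambda_L<\sum_{L\ge1}L\lambda_L<\sum_{L\ge1}L^2\lambda_L=\Lambda<\infty$. The curtain model is $X_D:=(X,D)$ with $D(x,y)=\sum_{L=1}^\infty\lambda_L d_L(x,y)$. Every isometry of $X$ is an isometry of $X_D$, so an action of $G$ on $X$ induces an action of $G$ on $X_D$. *)

theory Defs
  imports "HOL-Analysis.Analysis" "HOL-Algebra.Group_Action"
begin

section \<open>CAT(0) spaces\<close>

definition geodesic :: "real set \<Rightarrow> (real \<Rightarrow> 'a::metric_space) \<Rightarrow> bool" where
  "geodesic I \<alpha> \<longleftrightarrow> is_interval I \<and> closed I \<and> I \<noteq> {} \<and>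
     (\<forall>s\<in>I. \<forall>t\<in>I. dist (\<alpha> s) (\<alpha> t) = \<bar>s - t\<bar>)"

definition geodesic_segment :: "'a::metric_space \<Rightarrow> 'a \<Rightarrow> 'a set \<Rightarrow> bool" where
  "geodesic_segment x y S \<longleftrightarrow>
     (\<exists>\<alpha>. geodesic {0..dist x y} \<alpha> \<and> \<alpha> 0 = x \<and> \<alpha> (dist x y) = y \<and> S = \<alpha> ` {0..dist x y})"

text \<open>Pairs consisting of a point of a side \<open>S\<close> from \<open>x\<close> to \<open>y\<close> and its comparison point on the
  Euclidean segment from \<open>x'\<close> to \<open>y'\<close>.\<close>

definition comparison_pairs ::
  "'a::metric_space \<Rightarrow> 'a \<Rightarrow> 'a set \<Rightarrow> real^2 \<Rightarrow> real^2 \<Rightarrow> ('a \<times> (real^2)) set" where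
  "comparison_pairs x y S x' y' =
     {(u, u'). u \<in> S \<and> u' \<in> closed_segment x' y' \<and> dist x' u' = dist x u}"

text \<open>The argument only names the type whose universe is the space.\<close>

definition CAT0 :: "'a::metric_space itself \<Rightarrow> bool" where
  "CAT0 (_ :: 'a itself) \<longleftrightarrow>
     (\<forall>x y :: 'a. \<exists>S. geodesic_segment x y S) \<and>
     (\<forall>(x::'a) y z S T U (x' :: real^2) y' z'.
        geodesic_segment x y S \<and> geodesic_segment y z T \<and> geodesic_segment z x U \<and>
        dist x' y' = dist x y \<and> dist y' z' = dist y z \<and> dist z' x' = dist z x \<longrightarrow>
        (let C = comparison_pairs x y S x' y' \<union> comparison_pairs y z T y' z' \<union>
                 comparison_pairs z x U z' x'
         in \<forall>(u, u')\<in>C. \<forall>(v, v')\<in>C. dist u v \<le> dist u' v'))"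

section \<open>Curtains\<close>

text \<open>In a CAT(0) space every point has exactly one nearest point on a geodesic.\<close>

definition geodesic_proj :: "real set \<Rightarrow> (real \<Rightarrow> 'a::metric_space) \<Rightarrow> 'a \<Rightarrow> 'a" where
  "geodesic_proj I \<alpha> x = (THE p. p \<in> \<alpha> ` I \<and> (\<forall>q\<in>\<alpha> ` I. dist x p \<le> dist x q))"

definition curtain_data :: "real set \<Rightarrow> (real \<Rightarrow> 'a::metric_space) \<Rightarrow> real \<Rightarrow> bool" where
  "curtain_data I \<alpha> r \<longleftrightarrow> geodesic I \<alpha> \<and> {r - 1/2 .. r + 1/2} \<subseteq> interior I"

definition curtain :: "real set \<Rightarrow> (real \<Rightarrow> 'a::metric_space) \<Rightarrow> real \<Rightarrow> 'a set" where
  "curtain I \<alpha> r = geodesic_proj I \<alpha> -` (\<alpha> ` {r - 1/2 .. r + 1/2})"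

definition halfspace_minus :: "real set \<Rightarrow> (real \<Rightarrow> 'a::metric_space) \<Rightarrow> real \<Rightarrow> 'a set" where
  "halfspace_minus I \<alpha> r = geodesic_proj I \<alpha> -` (\<alpha> ` (I \<inter> {..< r - 1/2}))"

definition halfspace_plus :: "real set \<Rightarrow> (real \<Rightarrow> 'a::metric_space) \<Rightarrow> real \<Rightarrow> 'a set" where
  "halfspace_plus I \<alpha> r = geodesic_proj I \<alpha> -` (\<alpha> ` (I \<inter> {r + 1/2 <..}))"

definition is_curtain :: "'a::metric_space set \<Rightarrow> bool" where
  "is_curtain h \<longleftrightarrow> (\<exists>I \<alpha> r. curtain_data I \<alpha> r \<and> h = curtain I \<alpha> r)"

text \<open>Curtains are treated as subsets of the space. The choice of \<open>(I, \<alpha>, r)\<close> representing \<open>h\<close> is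
  immaterial: in a CAT(0) space the two halfspaces are the connected components of the complement
  of \<open>h\<close>, so they are determined by \<open>h\<close> up to interchange.\<close>

definition separates :: "'a::metric_space set \<Rightarrow> 'a set \<Rightarrow> 'a set \<Rightarrow> bool" where
  "separates h A B \<longleftrightarrow>
     (\<exists>I \<alpha> r. curtain_data I \<alpha> r \<and> h = curtain I \<alpha> r \<and>
        (A \<subseteq> halfspace_minus I \<alpha> r \<and> B \<subseteq> halfspace_plus I \<alpha> r \<or>
         B \<subseteq> halfspace_minus I \<alpha> r \<and> A \<subseteq> halfspace_plus I \<alpha> r))"

text \<open>The index set \<open>J\<close> is a finite or infinite set of consecutive integers, possibly empty. The
  separation condition concerns those \<open>i\<close> that have both neighbours in \<open>J\<close>.\<close>

definition chain :: "'a::metric_space set set \<Rightarrow> bool" where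
  "chain c \<longleftrightarrow> (\<forall>h\<in>c. is_curtain h) \<and>
     (\<exists>(J :: int set) h. (\<forall>i\<in>J. \<forall>j\<in>J. {i..j} \<subseteq> J) \<and> bij_betw h J c \<and>
        (\<forall>i. i - 1 \<in> J \<and> i \<in> J \<and> i + 1 \<in> J \<longrightarrow> separates (h i) (h (i - 1)) (h (i + 1))))"

definition chain_separates :: "'a::metric_space set set \<Rightarrow> 'a set \<Rightarrow> 'a set \<Rightarrow> bool" where
  "chain_separates c A B \<longleftrightarrow> (\<forall>h\<in>c. separates h A B)"

definition L_separated :: "nat \<Rightarrow> 'a::metric_space set \<Rightarrow> 'a set \<Rightarrow> bool" where
  "L_separated L h h' \<longleftrightarrow> is_curtain h \<and> is_curtain h' \<and> h \<inter> h' = {} \<and>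
     (\<forall>c. chain c \<and> (\<forall>k\<in>c. k \<inter> h \<noteq> {} \<and> k \<inter> h' \<noteq> {}) \<longrightarrow> finite c \<and> card c \<le> L)"

definition L_chain :: "nat \<Rightarrow> 'a::metric_space set set \<Rightarrow> bool" where
  "L_chain L c \<longleftrightarrow> chain c \<and> pairwise (L_separated L) c"

section \<open>The curtain model\<close>

text \<open>The maximum exists in a CAT(0) space: the empty chain separates any two points, and an
  \<open>L\<close>-chain separating \<open>x\<close> from \<open>y\<close> is finite with at most \<open>dist x y\<close> elements.\<close>

definition dist_L :: "nat \<Rightarrow> 'a::metric_space \<Rightarrow> 'a \<Rightarrow> nat" where
  "dist_L L x y =
     (if x = y then 0 else 1 + Max {card c | c. L_chain L c \<and> chain_separates c {x} {y}})"

text \<open>Weights are indexed by \<open>L \<ge> 1\<close>; the value at \<open>0\<close> is irrelevant.\<close>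

definition curtain_weights :: "(nat \<Rightarrow> real) \<Rightarrow> bool" where
  "curtain_weights w \<longleftrightarrow> (\<forall>L\<ge>1. 0 < w L \<and> w L < 1) \<and>
     summable (\<lambda>n. w (Suc n)) \<and>
     summable (\<lambda>n. real (Suc n) * w (Suc n)) \<and>
     summable (\<lambda>n. (real (Suc n))\<^sup>2 * w (Suc n)) \<and>
     (\<Sum>n. w (Suc n)) < (\<Sum>n. real (Suc n) * w (Suc n)) \<and>
     (\<Sum>n. real (Suc n) * w (Suc n)) < (\<Sum>n. (real (Suc n))\<^sup>2 * w (Suc n))"

definition curtain_dist :: "(nat \<Rightarrow> real) \<Rightarrow> 'a::metric_space \<Rightarrow> 'a \<Rightarrow> real" where
  "curtain_dist w x y = (\<Sum>n. w (Suc n) * real (dist_L (Suc n) x y))"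

section \<open>Actions\<close>

definition isometric_action ::
  "('g, 'm) monoid_scheme \<Rightarrow> ('g \<Rightarrow> 'a::metric_space \<Rightarrow> 'a) \<Rightarrow> bool" where
  "isometric_action G \<phi> \<longleftrightarrow> group_action G UNIV \<phi> \<and>
     (\<forall>g\<in>carrier G. \<forall>x y. dist (\<phi> g x) (\<phi> g y) = dist x y)"

definition cocompact_action ::
  "('g, 'm) monoid_scheme \<Rightarrow> ('g \<Rightarrow> 'a::metric_space \<Rightarrow> 'a) \<Rightarrow> bool" where
  "cocompact_action G \<phi> \<longleftrightarrow> (\<exists>K. compact K \<and> (\<Union>g\<in>carrier G. \<phi> g ` K) = UNIV)"

definition coarse_kernel ::
  "('g, 'm) monoid_scheme \<Rightarrow> ('g \<Rightarrow> 'z \<Rightarrow> 'z) \<Rightarrow> ('z \<Rightarrow> 'z \<Rightarrow> real) \<Rightarrow> 'g set" where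
  "coarse_kernel G \<phi> d = {g \<in> carrier G. \<exists>C>0. \<forall>z. d (\<phi> g z) z \<le> C}"

end

theory Submission
  imports Defs
begin

text \<open>
  Write \<open>d\<close> for the metric of \<open>X\<close>, \<open>d\<^sub>L\<close> for \<open>dist_L L\<close>, \<open>D\<close> for the metric of the curtain model and
  \<open>W\<close> for the sum of the weights.

  A geodesic that crosses pairwise disjoint curtains has, inside each of them, a stretch of length 1
  around a centre, so it crosses boundedly many per unit length. Hence \<open>d\<^sub>L \<le> 2 d + 2\<close> and
  \<open>D \<le> W (2 d + 2)\<close> (\<open>curtain_dist_le\<close>), and an element that moves points a bounded distance in \<open>X\<close>
  does so in the curtain model.

  Conversely, let \<open>g\<close> move every point at most \<open>C\<close> with respect to \<open>D\<close>. As \<open>D\<close> is unbounded, there is a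
  pair \<open>a\<close>, \<open>b\<close> with \<open>D(a,b) > 2 C + 5 W + 1\<close>. All the \<open>d\<^sub>L(a,b)\<close> are bounded by \<open>2 d(a,b) + 2\<close>, so the scales
  beyond some \<open>N\<close> contribute less than 1 to \<open>D(a,b)\<close>, and therefore some \<open>L \<le> N\<close> satisfies
  \<open>d\<^sub>L(a,b) \<ge> d\<^sub>L(a,ga) + d\<^sub>L(b,gb) + 5\<close> (\<open>scale_with_surviving_L_distance\<close>). Take a largest \<open>L\<close>-chain
  separating \<open>a\<close> from \<open>b\<close>. Few of its curtains separate \<open>a\<close> from \<open>ga\<close> or \<open>b\<close> from \<open>gb\<close>, and at most two contain
  \<open>ga\<close> or \<open>gb\<close>; what remains includes two curtains \<open>h\<close>, \<open>k\<close> that separate \<open>a\<close> from \<open>b\<close> and also \<open>ga\<close>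
  from \<open>gb\<close> (\<open>exists_two_curtains_separating_both\<close>). Both geodesics \<open>[a,b]\<close> and \<open>[ga,gb]\<close>, which have the
  same length, then cross both \<open>h\<close> and \<open>k\<close>. If they crossed \<open>h\<close> in points \<open>u\<close>, \<open>v\<close> that are very far apart, a long
  chain of curtains dual to \<open>[u,v]\<close> would cut \<open>h\<close> and \<open>k\<close>, as both are connected and reach from near \<open>u\<close> to
  near \<open>v\<close>; but \<open>h\<close> and \<open>k\<close> are \<open>L\<close>-separated (\<open>L_separated_crossings_close\<close>). So
  \<open>d(a,ga) \<le> 4 d(a,b) + 2 L + 3\<close>. The argument applies with the same \<open>N\<close> to every translate of the pair
  under \<open>G\<close>, because \<open>d\<close> and \<open>D\<close> are invariant, and by cocompactness every point is uniformly close to a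
  translate of \<open>a\<close>.

  Besides the existence of geodesics, two facts of CAT(0) geometry enter: projection to a geodesic is well defined and 1-Lipschitz
  (\<open>foot_lipschitz\<close>), and preimages of intervals under it are connected (\<open>connected_foot_vimage\<close>).
  They identify the halfspaces of a curtain with the components of its complement, so that
  separation can be discussed without choosing a dual geodesic (\<open>separates_iff\<close>). This gives the
  linear order of a chain, and hence that the members of an \<open>L\<close>-chain separating two given points
  form an \<open>L\<close>-chain again (\<open>L_chain_separating_subset\<close>).
\<close>

section \<open>Comparison triangles, geodesic segments and weights\<close>

lemma dist_affine_combination_squared:
  fixes x y z :: "'b::real_inner"
  shows "(dist z ((1 - t) *\<^sub>R x + t *\<^sub>R y))\<^sup>2 =
    (1 - t) * (dist z x)\<^sup>2 + t * (dist z y)\<^sup>2 - t * (1 - t) * (dist x y)\<^sup>2"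
  unfolding dist_norm power2_norm_eq_inner
  by (simp add: inner_diff_left inner_diff_right inner_add_left inner_add_right inner_commute
      algebra_simps)

lemma comparison_triangle_exists:
  fixes x y z :: "'b::metric_space"
  obtains x' y' z' :: "real^2"
  where "dist x' y' = dist x y" "dist y' z' = dist y z" "dist z' x' = dist z x"
proof (cases "x = y")
  case True
  have "dist (vector [dist z x, 0] :: real^2) 0 = dist z x"
    by (simp add: dist_norm norm_vec_def L2_set_def sum_2)
  then show ?thesis
    using True that[of 0 0 "vector [dist z x, 0]"] by (simp add: dist_commute)
next
  case False
  define c where "c = dist x y"
  define b where "b = dist z x"
  define a where "a = dist y z"
  define u where "u = (c\<^sup>2 + b\<^sup>2 - a\<^sup>2) / (2 * c)"
  define v where "v = sqrt (b\<^sup>2 - u\<^sup>2)"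
  have c: "c > 0" and b: "b \<ge> 0" and a: "a \<ge> 0"
    using False by (auto simp: c_def b_def a_def)
  \<comment> \<open>Put the first side on the horizontal axis; \<open>u\<close> is the coordinate that the law of cosines assigns to the
    third vertex, and the triangle inequalities say precisely that \<open>v\<close> is real.\<close>
  have "c \<le> a + b" "b \<le> a + c" "a \<le> b + c"
    unfolding a_def b_def c_def
    using dist_triangle[of x y z] dist_triangle[of z x y] dist_triangle[of y z x]
    by (auto simp: dist_commute)
  then have "\<bar>c - b\<bar> \<le> \<bar>a\<bar>" "\<bar>a\<bar> \<le> \<bar>c + b\<bar>" using a b c by auto
  then have "(c - b)\<^sup>2 \<le> a\<^sup>2" "a\<^sup>2 \<le> (c + b)\<^sup>2" by (simp_all only: abs_le_square_iff)
  then have "c\<^sup>2 + b\<^sup>2 - a\<^sup>2 \<le> b * (2 * c)" "- (b * (2 * c)) \<le> c\<^sup>2 + b\<^sup>2 - a\<^sup>2"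
    by (auto simp: power2_eq_square algebra_simps)
  then have "u \<le> b" "- b \<le> u"
    using c unfolding u_def by (simp_all add: pos_divide_le_eq pos_le_divide_eq)
  then have "\<bar>u\<bar> \<le> \<bar>b\<bar>" by auto
  then have "u\<^sup>2 \<le> b\<^sup>2" by (simp only: abs_le_square_iff)
  then have v: "v\<^sup>2 = b\<^sup>2 - u\<^sup>2" by (simp add: v_def)
  have cu: "2 * c * u = c\<^sup>2 + b\<^sup>2 - a\<^sup>2" using c by (simp add: u_def)
  have "(c - u)\<^sup>2 + v\<^sup>2 = a\<^sup>2"
    using v cu by (simp add: power2_diff)
  then have "dist (vector [c, 0] :: real^2) (vector [u, v]) = a"
    using a by (simp add: dist_norm norm_vec_def L2_set_def sum_2)
  moreover have "dist (vector [u, v] :: real^2) 0 = b"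
    using v b by (simp add: dist_norm norm_vec_def L2_set_def sum_2)
  moreover have "dist 0 (vector [c, 0] :: real^2) = c"
    using c by (simp add: dist_norm norm_vec_def L2_set_def sum_2)
  ultimately show ?thesis
    using that[of 0 "vector [c, 0]" "vector [u, v]"] by (simp add: a_def b_def c_def)
qed

lemma geodesicD:
  assumes "geodesic I \<alpha>"
  shows "is_interval I" "closed I" "I \<noteq> {}"
    "\<And>s t. s \<in> I \<Longrightarrow> t \<in> I \<Longrightarrow> dist (\<alpha> s) (\<alpha> t) = \<bar>s - t\<bar>"
  using assms by (auto simp: geodesic_def)

lemma geodesic_inj_on: "geodesic I \<alpha> \<Longrightarrow> inj_on \<alpha> I"
  using geodesicD(4) by (fastforce intro!: inj_onI)

lemma geodesic_continuous_on:
  assumes "geodesic I \<alpha>" shows "continuous_on I \<alpha>"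
  unfolding continuous_on_iff
proof (intro ballI allI impI)
  fix s and e :: real assume "s \<in> I" "0 < e"
  then show "\<exists>d>0. \<forall>t\<in>I. dist t s < d \<longrightarrow> dist (\<alpha> t) (\<alpha> s) < e"
    using geodesicD(4)[OF assms] by (intro exI[of _ e]) (auto simp: dist_real_def)
qed

lemma geodesic_segment_of_geodesic:
  assumes "geodesic I \<alpha>" "s \<in> I" "t \<in> I" "s \<le> t"
  shows "geodesic_segment (\<alpha> s) (\<alpha> t) (\<alpha> ` {s..t})"
proof -
  have sub: "{s..t} \<subseteq> I"
    using mem_is_interval_1_I[OF geodesicD(1)[OF assms(1)] assms(2,3)] by auto
  have d: "dist (\<alpha> s) (\<alpha> t) = t - s" using geodesicD(4)[OF assms(1-3)] assms(4) by simp
  have *: "geodesic {0..t - s} (\<lambda>u. \<alpha> (s + u))"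
    unfolding geodesic_def using geodesicD(4)[OF assms(1)] sub assms(4)
    by (auto simp: is_interval_cc subset_iff)
  have img: "\<alpha> ` {s..t} = (\<lambda>u. \<alpha> (s + u)) ` {0..t - s}"
  proof -
    have "(\<lambda>u. \<alpha> (s + u)) ` {0..t - s} = \<alpha> ` ((+) s ` {0..t - s})"
      by (simp only: image_image)
    then show ?thesis by (simp only: image_add_atLeastAtMost) simp
  qed
  show ?thesis
    unfolding geodesic_segment_def d using * img by (intro exI[of _ "\<lambda>u. \<alpha> (s + u)"]) simp
qed

lemma curtain_weightsD:
  assumes "curtain_weights w"
  shows "0 < w (Suc n)" "summable (\<lambda>n. w (Suc n))"
  using assms by (simp_all add: curtain_weights_def)

section \<open>Projections onto geodesics in CAT(0) spaces\<close>

text \<open>The parameter of the nearest point of \<open>\<alpha>\<close>. It is a real number, so that curtains and halfspaces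
  become preimages of intervals and the intermediate value theorem applies.\<close>

definition foot :: "real set \<Rightarrow> (real \<Rightarrow> 'a::metric_space) \<Rightarrow> 'a \<Rightarrow> real" where
  "foot I \<alpha> x = (THE t. t \<in> I \<and> (\<forall>s\<in>I. dist x (\<alpha> t) \<le> dist x (\<alpha> s)))"

context
  assumes CAT0: "CAT0 TYPE('a::metric_space)"
begin

lemma geodesic_joining_exists:
  fixes x y :: 'a
  obtains \<alpha> where "geodesic {0..dist x y} \<alpha>" "\<alpha> 0 = x" "\<alpha> (dist x y) = y"
  using CAT0 unfolding CAT0_def geodesic_segment_def by blast

text \<open>The comparison axiom applied to the vertex \<open>z\<close> and a point on the opposite side, combined with
  Stewart's formula in the plane. For \<open>\<theta> = 1/2\<close> this is the inequality of Bruhat and Tits. It is the only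
  consequence of the comparison axiom that is used below.\<close>

lemma CAT0_dist_geodesic_le:
  fixes \<alpha> :: "real \<Rightarrow> 'a"
  assumes \<alpha>: "geodesic I \<alpha>" and st: "s \<in> I" "t \<in> I" and \<theta>: "0 \<le> \<theta>" "\<theta> \<le> 1"
  shows "(dist z (\<alpha> ((1 - \<theta>) * s + \<theta> * t)))\<^sup>2 \<le>
    (1 - \<theta>) * (dist z (\<alpha> s))\<^sup>2 + \<theta> * (dist z (\<alpha> t))\<^sup>2 - \<theta> * (1 - \<theta>) * (s - t)\<^sup>2"
proof -
  have main: "(dist z (\<alpha> ((1 - \<theta>) * s + \<theta> * t)))\<^sup>2 \<le>
    (1 - \<theta>) * (dist z (\<alpha> s))\<^sup>2 + \<theta> * (dist z (\<alpha> t))\<^sup>2 - \<theta> * (1 - \<theta>) * (s - t)\<^sup>2"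
    if st: "s \<in> I" "t \<in> I" "s \<le> t" and \<theta>: "0 \<le> \<theta>" "\<theta> \<le> 1" for s t \<theta>
  proof -
    define S where "S = \<alpha> ` {s..t}"
    have S: "geodesic_segment (\<alpha> s) (\<alpha> t) S"
      unfolding S_def using geodesic_segment_of_geodesic[OF \<alpha> st] .
    obtain T where T: "geodesic_segment (\<alpha> t) z T" using CAT0 unfolding CAT0_def by blast
    obtain U where U: "geodesic_segment z (\<alpha> s) U" using CAT0 unfolding CAT0_def by blast
    obtain x' y' z' :: "real^2" where d: "dist x' y' = dist (\<alpha> s) (\<alpha> t)"
      "dist y' z' = dist (\<alpha> t) z" "dist z' x' = dist z (\<alpha> s)"
      using comparison_triangle_exists .
    define C where "C = comparison_pairs (\<alpha> s) (\<alpha> t) S x' y' \<union>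
      comparison_pairs (\<alpha> t) z T y' z' \<union> comparison_pairs z (\<alpha> s) U z' x'"
    have C: "\<forall>(u, u')\<in>C. \<forall>(v, v')\<in>C. dist u v \<le> dist u' v'"
      using CAT0 S T U d unfolding CAT0_def Let_def C_def by blast
    define r where "r = (1 - \<theta>) * s + \<theta> * t"
    have r: "r = s + \<theta> * (t - s)" by (simp add: r_def algebra_simps)
    have "\<theta> * (t - s) \<le> 1 * (t - s)" using st \<theta> by (intro mult_right_mono) auto
    then have rs: "r \<in> {s..t}" using st \<theta> by (simp add: r)
    then have "r \<in> I" using mem_is_interval_1_I[OF geodesicD(1)[OF \<alpha>] st(1,2)] by simp
    then have dr: "dist (\<alpha> s) (\<alpha> r) = \<theta> * (t - s)"
      using geodesicD(4)[OF \<alpha> st(1) \<open>r \<in> I\<close>] st \<theta> by (simp add: r)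
    have dst: "dist (\<alpha> s) (\<alpha> t) = t - s" using geodesicD(4)[OF \<alpha> st(1,2)] st by simp
    define m' where "m' = (1 - \<theta>) *\<^sub>R x' + \<theta> *\<^sub>R y'"
    have "x' - m' = \<theta> *\<^sub>R (x' - y')" by (simp add: m'_def algebra_simps)
    then have "dist x' m' = \<theta> * (t - s)" using \<theta> d(1) dst by (simp add: dist_norm)
    then have 1: "(\<alpha> r, m') \<in> C"
      using rs dr \<theta> by (auto simp: C_def comparison_pairs_def S_def m'_def in_segment)
    have "z \<in> U" using U unfolding geodesic_segment_def by (auto intro: rev_image_eqI[of 0])
    then have 2: "(z, z') \<in> C" by (auto simp: C_def comparison_pairs_def)
    have "dist z (\<alpha> r) \<le> dist z' m'" using C 1 2 by blast
    then have "(dist z (\<alpha> r))\<^sup>2 \<le> (dist z' m')\<^sup>2" by (simp add: power_mono)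
    also have "\<dots> = (1 - \<theta>) * (dist z' x')\<^sup>2 + \<theta> * (dist z' y')\<^sup>2 - \<theta> * (1 - \<theta>) * (dist x' y')\<^sup>2"
      unfolding m'_def by (rule dist_affine_combination_squared)
    also have "\<dots> = (1 - \<theta>) * (dist z (\<alpha> s))\<^sup>2 + \<theta> * (dist z (\<alpha> t))\<^sup>2 - \<theta> * (1 - \<theta>) * (s - t)\<^sup>2"
      using d dst by (simp add: dist_commute power2_commute)
    finally show ?thesis by (simp add: r_def)
  qed
  show ?thesis
  proof (cases "s \<le> t")
    case True then show ?thesis using main st \<theta> by blast
  next
    case False
    then show ?thesis using main[of t s "1 - \<theta>"] st \<theta> by (simp add: algebra_simps power2_commute)
  qed
qed

text \<open>Let \<open>m\<close> be the midpoint of the diagonal from \<open>x\<close> to \<open>q\<close>. The previous inequality bounds the distances of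
  \<open>y\<close> and \<open>p\<close> from \<open>m\<close> by the four sides, and the other diagonal is at most the path through \<open>m\<close>.\<close>

lemma CAT0_quadrilateral:
  fixes x y p q :: 'a
  shows "(dist x q)\<^sup>2 + (dist y p)\<^sup>2 \<le>
    (dist x p)\<^sup>2 + (dist y q)\<^sup>2 + (dist x y)\<^sup>2 + (dist p q)\<^sup>2"
proof -
  obtain \<alpha> where \<alpha>: "geodesic {0..dist x q} \<alpha>" "\<alpha> 0 = x" "\<alpha> (dist x q) = q"
    using geodesic_joining_exists .
  define m where "m = \<alpha> (dist x q / 2)"
  have *: "(dist z m)\<^sup>2 \<le> (dist z x)\<^sup>2 / 2 + (dist z q)\<^sup>2 / 2 - (dist x q)\<^sup>2 / 4" for z
    using CAT0_dist_geodesic_le[OF \<alpha>(1), of 0 "dist x q" "1/2" z]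
    unfolding m_def \<alpha>(2,3) by (simp add: \<alpha>(2,3))
  have "(dist y p)\<^sup>2 \<le> (dist y m + dist p m)\<^sup>2"
    by (intro power_mono dist_triangle2) auto
  also have "\<dots> \<le> 2 * (dist y m)\<^sup>2 + 2 * (dist p m)\<^sup>2"
    using zero_le_power2[of "dist y m - dist p m"]
    by (simp add: power2_sum power2_diff)
  finally show ?thesis
    using *[of y, unfolded dist_commute[of y x]] *[of p, unfolded dist_commute[of p x]]
    by linarith
qed

text \<open>The angle at a nearest point is at least a right angle. In metric terms: move from the nearest
  point a fraction \<open>\<theta>\<close> of the way towards \<open>\<alpha> s\<close>, which does not decrease the distance to \<open>x\<close>, divide
  the convexity inequality by \<open>\<theta>\<close> and let \<open>\<theta>\<close> tend to 0.\<close>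

lemma nearest_point_pythagoras:
  fixes \<alpha> :: "real \<Rightarrow> 'a"
  assumes \<alpha>: "geodesic I \<alpha>" and t: "t \<in> I" "\<And>u. u \<in> I \<Longrightarrow> dist x (\<alpha> t) \<le> dist x (\<alpha> u)"
    and s: "s \<in> I"
  shows "(dist x (\<alpha> t))\<^sup>2 + (t - s)\<^sup>2 \<le> (dist x (\<alpha> s))\<^sup>2"
proof -
  define F where "F \<theta> = (dist x (\<alpha> s))\<^sup>2 - (1 - \<theta>) * (t - s)\<^sup>2" for \<theta> :: real
  have F: "(dist x (\<alpha> t))\<^sup>2 \<le> F \<theta>" if \<theta>: "0 < \<theta>" "\<theta> < 1" for \<theta>
  proof -
    have "(1 - \<theta>) * t + \<theta> * s \<in> I"
      using geodesicD(1)[OF \<alpha>] t(1) s \<theta> convexD[of I t s "1 - \<theta>" \<theta>]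
      by (simp add: is_interval_convex_1)
    then have "(dist x (\<alpha> t))\<^sup>2 \<le> (dist x (\<alpha> ((1 - \<theta>) * t + \<theta> * s)))\<^sup>2"
      using t(2) by (simp add: power_mono)
    also have "\<dots> \<le> (1 - \<theta>) * (dist x (\<alpha> t))\<^sup>2 + \<theta> * (dist x (\<alpha> s))\<^sup>2 - \<theta> * (1 - \<theta>) * (t - s)\<^sup>2"
      using CAT0_dist_geodesic_le[OF \<alpha> t(1) s] \<theta> by simp
    finally have "\<theta> * (dist x (\<alpha> t))\<^sup>2 \<le> \<theta> * F \<theta>"
      by (simp add: F_def algebra_simps)
    then show ?thesis using \<theta> by simp
  qed
  have "(F \<longlongrightarrow> F 0) (at_right 0)"
    unfolding F_def by (intro tendsto_intros)
  moreover have "eventually (\<lambda>\<theta>. (dist x (\<alpha> t))\<^sup>2 \<le> F \<theta>) (at_right 0)"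
    unfolding eventually_at_right_field using F by (intro exI[of _ 1]) simp
  ultimately have "(dist x (\<alpha> t))\<^sup>2 \<le> F 0"
    by (intro tendsto_lowerbound) auto
  then show ?thesis by (simp add: F_def)
qed

text \<open>Points of \<open>\<alpha>\<close> at distance more than \<open>2 d(x, \<alpha> t\<^sub>0)\<close> from \<open>\<alpha> t\<^sub>0\<close> are farther from \<open>x\<close> than \<open>\<alpha> t\<^sub>0\<close> is,
  so it suffices to minimise over a compact set of parameters.\<close>

lemma nearest_point_exists:
  fixes \<alpha> :: "real \<Rightarrow> 'a"
  assumes \<alpha>: "geodesic I \<alpha>"
  obtains t where "t \<in> I" "\<And>s. s \<in> I \<Longrightarrow> dist x (\<alpha> t) \<le> dist x (\<alpha> s)"
proof -
  obtain t0 where t0: "t0 \<in> I" using geodesicD(3)[OF \<alpha>] by blast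
  define R where "R = 2 * dist x (\<alpha> t0)"
  define K where "K = I \<inter> cball t0 R"
  have K: "compact K" "t0 \<in> K"
    using geodesicD(2)[OF \<alpha>] t0 by (auto simp: K_def R_def closed_Int_compact)
  have "continuous_on K (\<lambda>t. dist x (\<alpha> t))"
    using continuous_on_subset[OF geodesic_continuous_on[OF \<alpha>], of K]
    by (intro continuous_intros) (auto simp: K_def)
  then obtain t where t: "t \<in> K" "\<And>s. s \<in> K \<Longrightarrow> dist x (\<alpha> t) \<le> dist x (\<alpha> s)"
    using continuous_attains_inf[OF K(1)] K(2) by blast
  have "dist x (\<alpha> t) \<le> dist x (\<alpha> s)" if "s \<in> I" for s
  proof (cases "s \<in> K")
    case False
    then have "R < dist (\<alpha> t0) (\<alpha> s)"
      using that geodesicD(4)[OF \<alpha> t0 that] by (auto simp: K_def dist_real_def)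
    then have "dist x (\<alpha> t0) \<le> dist x (\<alpha> s)"
      using dist_triangle[of "\<alpha> t0" "\<alpha> s" x] by (simp add: R_def dist_commute)
    then show ?thesis using t(2)[OF K(2)] by simp
  qed (use t in auto)
  then show ?thesis using that t(1) by (auto simp: K_def)
qed

lemma foot_eqI:
  fixes \<alpha> :: "real \<Rightarrow> 'a"
  assumes \<alpha>: "geodesic I \<alpha>" and t: "t \<in> I" "\<And>s. s \<in> I \<Longrightarrow> dist x (\<alpha> t) \<le> dist x (\<alpha> s)"
  shows "foot I \<alpha> x = t"
  unfolding foot_def
proof (rule the_equality)
  fix u assume u: "u \<in> I \<and> (\<forall>s\<in>I. dist x (\<alpha> u) \<le> dist x (\<alpha> s))"
  then have "dist x (\<alpha> u) = dist x (\<alpha> t)" using t by (intro order_antisym) simp_all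
  moreover have "(dist x (\<alpha> t))\<^sup>2 + (t - u)\<^sup>2 \<le> (dist x (\<alpha> u))\<^sup>2"
    using nearest_point_pythagoras[OF \<alpha> t] u by blast
  ultimately show "u = t" by simp
qed (use t in auto)

lemma
  fixes \<alpha> :: "real \<Rightarrow> 'a"
  assumes \<alpha>: "geodesic I \<alpha>"
  shows foot_in: "foot I \<alpha> x \<in> I"
    and foot_le: "s \<in> I \<Longrightarrow> dist x (\<alpha> (foot I \<alpha> x)) \<le> dist x (\<alpha> s)"
proof -
  obtain t where t: "t \<in> I" "\<And>s. s \<in> I \<Longrightarrow> dist x (\<alpha> t) \<le> dist x (\<alpha> s)"
    using nearest_point_exists[OF \<alpha>, of x] by blast
  have "foot I \<alpha> x = t" using foot_eqI[OF \<alpha> t] .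
  with t show "foot I \<alpha> x \<in> I" "s \<in> I \<Longrightarrow> dist x (\<alpha> (foot I \<alpha> x)) \<le> dist x (\<alpha> s)"
    by simp_all
qed

lemma foot_pythagoras:
  fixes \<alpha> :: "real \<Rightarrow> 'a"
  assumes \<alpha>: "geodesic I \<alpha>" and s: "s \<in> I"
  shows "(dist x (\<alpha> (foot I \<alpha> x)))\<^sup>2 + (foot I \<alpha> x - s)\<^sup>2 \<le> (dist x (\<alpha> s))\<^sup>2"
  using nearest_point_pythagoras[OF \<alpha> foot_in[OF \<alpha>] foot_le[OF \<alpha>] s] .

lemma foot_geodesic:
  fixes \<alpha> :: "real \<Rightarrow> 'a"
  assumes "geodesic I \<alpha>" "t \<in> I"
  shows "foot I \<alpha> (\<alpha> t) = t"
  using assms by (intro foot_eqI) auto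

lemma geodesic_proj_eq_foot:
  fixes \<alpha> :: "real \<Rightarrow> 'a"
  assumes \<alpha>: "geodesic I \<alpha>"
  shows "geodesic_proj I \<alpha> x = \<alpha> (foot I \<alpha> x)"
  unfolding geodesic_proj_def
proof (rule the_equality)
  fix p assume p: "p \<in> \<alpha> ` I \<and> (\<forall>q\<in>\<alpha> ` I. dist x p \<le> dist x q)"
  then obtain t where "t \<in> I" "p = \<alpha> t" by blast
  then show "p = \<alpha> (foot I \<alpha> x)" using foot_eqI[OF \<alpha>, of t x] p by simp
qed (use foot_in[OF \<alpha>] foot_le[OF \<alpha>] in auto)

text \<open>In the quadrilateral formed by \<open>x\<close>, \<open>y\<close> and their projections, the two Pythagorean inequalities bound
  the diagonals from below and the quadrilateral inequality bounds them from above; on adding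
  up, only the distances between \<open>x\<close> and \<open>y\<close> and between their projections survive.\<close>

lemma foot_lipschitz:
  fixes \<alpha> :: "real \<Rightarrow> 'a"
  assumes \<alpha>: "geodesic I \<alpha>"
  shows "\<bar>foot I \<alpha> x - foot I \<alpha> y\<bar> \<le> dist x y"
proof -
  define s where "s = foot I \<alpha> x"
  define t where "t = foot I \<alpha> y"
  have I: "s \<in> I" "t \<in> I" by (simp_all add: s_def t_def foot_in[OF \<alpha>])
  have "(dist x (\<alpha> s))\<^sup>2 + (s - t)\<^sup>2 \<le> (dist x (\<alpha> t))\<^sup>2"
    "(dist y (\<alpha> t))\<^sup>2 + (t - s)\<^sup>2 \<le> (dist y (\<alpha> s))\<^sup>2"
    using foot_pythagoras[OF \<alpha> I(2), of x] foot_pythagoras[OF \<alpha> I(1), of y]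
    by (simp_all add: s_def t_def)
  moreover have "(dist (\<alpha> s) (\<alpha> t))\<^sup>2 = (s - t)\<^sup>2" using geodesicD(4)[OF \<alpha> I] by simp
  ultimately have "(s - t)\<^sup>2 \<le> (dist x y)\<^sup>2"
    using CAT0_quadrilateral[of x "\<alpha> t" y "\<alpha> s"] power2_commute[of s t] by linarith
  then show ?thesis by (simp add: s_def t_def flip: abs_le_square_iff)
qed

lemma continuous_on_foot:
  fixes \<alpha> :: "real \<Rightarrow> 'a"
  assumes "geodesic I \<alpha>"
  shows "continuous_on A (foot I \<alpha>)"
  unfolding continuous_on_iff
proof (intro ballI allI impI)
  fix x and e :: real assume "0 < e"
  moreover have "dist (foot I \<alpha> y) (foot I \<alpha> x) \<le> dist y x" for y
    using foot_lipschitz[OF assms] by (simp add: dist_real_def)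
  ultimately show "\<exists>d>0. \<forall>y\<in>A. dist y x < d \<longrightarrow> dist (foot I \<alpha> y) (foot I \<alpha> x) < e"
    by (meson le_less_trans)
qed

text \<open>All points of the geodesic from \<open>x\<close> to its projection \<open>p\<close> project to \<open>p\<close> too, so this geodesic stays
  in the preimage and joins \<open>x\<close> to the connected piece of \<open>\<alpha>\<close> over the interval.\<close>

lemma connected_foot_vimage:
  fixes \<alpha> :: "real \<Rightarrow> 'a"
  assumes \<alpha>: "geodesic I \<alpha>" and T: "is_interval T"
  shows "connected {x. foot I \<alpha> x \<in> T}"
proof -
  let ?X = "{x. foot I \<alpha> x \<in> T}"
  have conv: "\<alpha> ` (I \<inter> T) \<subseteq> ?X" using foot_geodesic[OF \<alpha>] by auto
  have core: "connected (\<alpha> ` (I \<inter> T))"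
    using continuous_on_subset[OF geodesic_continuous_on[OF \<alpha>]] geodesicD(1)[OF \<alpha>] T
    by (intro connected_continuous_image) (auto simp: is_interval_connected_1[symmetric]
        intro: is_interval_Int)
  have to_core: "connected_component ?X x (\<alpha> (foot I \<alpha> x))" if x: "x \<in> ?X" for x
  proof -
    define p where "p = \<alpha> (foot I \<alpha> x)"
    obtain \<gamma> where \<gamma>: "geodesic {0..dist x p} \<gamma>" "\<gamma> 0 = x" "\<gamma> (dist x p) = p"
      using geodesic_joining_exists .
    have "foot I \<alpha> (\<gamma> u) = foot I \<alpha> x" if u: "u \<in> {0..dist x p}" for u
    proof (rule foot_eqI[OF \<alpha> foot_in[OF \<alpha>]])
      fix s assume s: "s \<in> I"
      have "dist x (\<gamma> u) = u" using geodesicD(4)[OF \<gamma>(1), of 0 u] u \<gamma> by auto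
      moreover have "dist (\<gamma> u) p = dist x p - u"
        using geodesicD(4)[OF \<gamma>(1), of u "dist x p"] u \<gamma> by auto
      moreover have "dist x p \<le> dist x (\<alpha> s)" using foot_le[OF \<alpha> s] by (simp add: p_def)
      ultimately show "dist (\<gamma> u) (\<alpha> (foot I \<alpha> x)) \<le> dist (\<gamma> u) (\<alpha> s)"
        using dist_triangle[of x "\<alpha> s" "\<gamma> u"] by (simp add: p_def)
    qed
    then have "\<gamma> ` {0..dist x p} \<subseteq> ?X" using x by auto
    moreover have "connected (\<gamma> ` {0..dist x p})"
      by (intro connected_continuous_image geodesic_continuous_on[OF \<gamma>(1)] connected_Icc)
    moreover have "x \<in> \<gamma> ` {0..dist x p}" "p \<in> \<gamma> ` {0..dist x p}"
      using imageI[of 0 "{0..dist x p}" \<gamma>] imageI[of "dist x p" "{0..dist x p}" \<gamma>]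
      unfolding \<gamma>(2,3) by simp_all
    ultimately show ?thesis unfolding connected_component_def p_def[symmetric] by metis
  qed
  show ?thesis
    unfolding connected_iff_connected_component
  proof (intro ballI)
    fix x y assume xy: "x \<in> ?X" "y \<in> ?X"
    have "connected_component ?X (\<alpha> (foot I \<alpha> x)) (\<alpha> (foot I \<alpha> y))"
      unfolding connected_component_def using core conv xy foot_in[OF \<alpha>] by blast
    then show "connected_component ?X x y"
      using to_core[OF xy(1)] to_core[OF xy(2)]
      by (meson connected_component_sym connected_component_trans)
  qed
qed

lemma foot_isometry:
  fixes \<alpha> :: "real \<Rightarrow> 'a" and f :: "'a \<Rightarrow> 'a"
  assumes \<alpha>: "geodesic I \<alpha>" and f: "\<And>x y. dist (f x) (f y) = dist x y"
  shows "geodesic I (f \<circ> \<alpha>)" "foot I (f \<circ> \<alpha>) (f x) = foot I \<alpha> x"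
proof -
  show *: "geodesic I (f \<circ> \<alpha>)" using \<alpha> by (simp add: geodesic_def f)
  show "foot I (f \<circ> \<alpha>) (f x) = foot I \<alpha> x"
    by (rule foot_eqI[OF * foot_in[OF \<alpha>]]) (simp add: f foot_le[OF \<alpha>])
qed


section \<open>Curtains and their sides\<close>

lemma
  fixes \<alpha> :: "real \<Rightarrow> 'a"
  assumes c: "curtain_data I \<alpha> r"
  shows mem_curtain_iff: "x \<in> curtain I \<alpha> r \<longleftrightarrow> foot I \<alpha> x \<in> {r - 1/2..r + 1/2}"
    and mem_halfspace_minus_iff: "x \<in> halfspace_minus I \<alpha> r \<longleftrightarrow> foot I \<alpha> x < r - 1/2"
    and mem_halfspace_plus_iff: "x \<in> halfspace_plus I \<alpha> r \<longleftrightarrow> r + 1/2 < foot I \<alpha> x"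
proof -
  have \<alpha>: "geodesic I \<alpha>" using c by (simp add: curtain_data_def)
  have sub: "{r - 1/2..r + 1/2} \<subseteq> I"
    using c interior_subset[of I] unfolding curtain_data_def by (meson order_trans)
  have *: "\<alpha> (foot I \<alpha> x) \<in> \<alpha> ` T \<longleftrightarrow> foot I \<alpha> x \<in> T" if "T \<subseteq> I" for T
    using inj_on_image_mem_iff[OF geodesic_inj_on[OF \<alpha>] foot_in[OF \<alpha>] that] .
  show "x \<in> curtain I \<alpha> r \<longleftrightarrow> foot I \<alpha> x \<in> {r - 1/2..r + 1/2}"
    using *[OF sub] by (simp add: curtain_def geodesic_proj_eq_foot[OF \<alpha>])
  show "x \<in> halfspace_minus I \<alpha> r \<longleftrightarrow> foot I \<alpha> x < r - 1/2"
    "x \<in> halfspace_plus I \<alpha> r \<longleftrightarrow> r + 1/2 < foot I \<alpha> x"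
    using *[of "I \<inter> {..<r - 1/2}"] *[of "I \<inter> {r + 1/2<..}"] foot_in[OF \<alpha>, of x]
    by (simp_all add: halfspace_minus_def halfspace_plus_def geodesic_proj_eq_foot[OF \<alpha>])
qed

lemma connected_meets_levels:
  fixes \<alpha> :: "real \<Rightarrow> 'a"
  assumes \<alpha>: "geodesic I \<alpha>" and C: "connected C" "x \<in> C" "y \<in> C"
    and t: "foot I \<alpha> x \<le> t" "t \<le> foot I \<alpha> y"
  obtains z where "z \<in> C" "foot I \<alpha> z = t"
proof -
  have "connected (foot I \<alpha> ` C)"
    using connected_continuous_image[OF continuous_on_foot[OF \<alpha>] C(1)] .
  then have "t \<in> foot I \<alpha> ` C"
    using connectedD_interval[of "foot I \<alpha> ` C" "foot I \<alpha> x" "foot I \<alpha> y" t] C t by simp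
  then show ?thesis using that by blast
qed

text \<open>A connected set that meets both sides takes the value \<open>r\<close> of the projection parameter and hence
  meets the curtain; the sides themselves are preimages of rays and so are connected.\<close>

lemma connected_component_curtain_iff:
  fixes \<alpha> :: "real \<Rightarrow> 'a"
  assumes c: "curtain_data I \<alpha> r" and xy: "x \<notin> curtain I \<alpha> r" "y \<notin> curtain I \<alpha> r"
  shows "connected_component (- curtain I \<alpha> r) x y \<longleftrightarrow> (foot I \<alpha> x < r \<longleftrightarrow> foot I \<alpha> y < r)"
proof -
  have \<alpha>: "geodesic I \<alpha>" using c by (simp add: curtain_data_def)
  let ?h = "curtain I \<alpha> r"
  note m = mem_curtain_iff[OF c]
  have no: "\<not> connected_component (- ?h) u v" if uv: "foot I \<alpha> u < r" "\<not> foot I \<alpha> v < r" for u v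
  proof
    assume "connected_component (- ?h) u v"
    then obtain T where T: "connected T" "T \<subseteq> - ?h" "u \<in> T" "v \<in> T"
      unfolding connected_component_def by blast
    obtain z where "z \<in> T" "foot I \<alpha> z = r"
      by (rule connected_meets_levels[OF \<alpha> T(1,3,4), of r]) (use uv in auto)
    then show False using T(2) m by auto
  qed
  have lo: "connected {z. foot I \<alpha> z \<in> {..<r - 1/2}}" and hi: "connected {z. foot I \<alpha> z \<in> {r + 1/2<..}}"
    by (intro connected_foot_vimage[OF \<alpha>] is_interval_io is_interval_oi)+
  have lo': "connected_component (- ?h) x y" if "foot I \<alpha> x < r" "foot I \<alpha> y < r"
    unfolding connected_component_def using lo that xy
    by (intro exI[of _ "{z. foot I \<alpha> z \<in> {..<r - 1/2}}"]) (auto simp: m)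
  have hi': "connected_component (- ?h) x y" if "\<not> foot I \<alpha> x < r" "\<not> foot I \<alpha> y < r"
    unfolding connected_component_def using hi that xy
    by (intro exI[of _ "{z. foot I \<alpha> z \<in> {r + 1/2<..}}"]) (auto simp: m)
  show ?thesis
    using no[of x y] no[of y x] lo' hi' connected_component_sym[of "- ?h" x y] by blast
qed

lemma curtain_two_sides:
  fixes h :: "'a set"
  assumes "is_curtain h" "x \<notin> h" "y \<notin> h" "z \<notin> h"
  shows "connected_component (- h) x y \<or> connected_component (- h) y z \<or> connected_component (- h) x z"
proof -
  obtain I \<alpha> r where c: "curtain_data I \<alpha> r" and h: "h = curtain I \<alpha> r"
    using assms(1) unfolding is_curtain_def by blast
  show ?thesis
    using assms(2-4) unfolding h by (auto simp: connected_component_curtain_iff[OF c])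
qed

text \<open>A description of separation that refers only to the set \<open>h\<close>. The definition allows a different
  dual geodesic for each pair of sets that \<open>h\<close> separates; this form makes such statements comparable.\<close>

lemma separates_iff:
  fixes h :: "'a set"
  shows "separates h A B \<longleftrightarrow> is_curtain h \<and> A \<inter> h = {} \<and> B \<inter> h = {} \<and>
    (\<forall>x\<in>A. \<forall>y\<in>A. connected_component (- h) x y) \<and>
    (\<forall>x\<in>B. \<forall>y\<in>B. connected_component (- h) x y) \<and>
    (\<forall>x\<in>A. \<forall>y\<in>B. \<not> connected_component (- h) x y)" (is "_ \<longleftrightarrow> ?R")
proof
  assume "separates h A B"
  then obtain I \<alpha> r where c: "curtain_data I \<alpha> r" and h: "h = curtain I \<alpha> r" and
    AB: "A \<subseteq> halfspace_minus I \<alpha> r \<and> B \<subseteq> halfspace_plus I \<alpha> r \<or>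
     B \<subseteq> halfspace_minus I \<alpha> r \<and> A \<subseteq> halfspace_plus I \<alpha> r"
    unfolding separates_def by blast
  note m = mem_curtain_iff[OF c] mem_halfspace_minus_iff[OF c] mem_halfspace_plus_iff[OF c]
  have AB': "(\<forall>x\<in>A. foot I \<alpha> x < r - 1/2) \<and> (\<forall>x\<in>B. r + 1/2 < foot I \<alpha> x) \<or>
    (\<forall>x\<in>B. foot I \<alpha> x < r - 1/2) \<and> (\<forall>x\<in>A. r + 1/2 < foot I \<alpha> x)"
    using AB unfolding subset_iff m by blast
  have "x \<notin> h" if "x \<in> A \<union> B" for x
    using AB' that unfolding h m by auto
  then have d: "A \<inter> h = {}" "B \<inter> h = {}" by blast+
  have side: "(\<forall>x\<in>A. foot I \<alpha> x < r) \<and> (\<forall>x\<in>B. \<not> foot I \<alpha> x < r) \<or>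
    (\<forall>x\<in>B. foot I \<alpha> x < r) \<and> (\<forall>x\<in>A. \<not> foot I \<alpha> x < r)"
    using AB' by (elim disjE conjE) (simp_all add: Ball_def, force+)
  have cc: "connected_component (- h) x y \<longleftrightarrow> (foot I \<alpha> x < r \<longleftrightarrow> foot I \<alpha> y < r)"
    if "x \<in> A \<union> B" "y \<in> A \<union> B" for x y
    using connected_component_curtain_iff[OF c] d that unfolding h by blast
  have "is_curtain h" using c h unfolding is_curtain_def by blast
  then show ?R using d side by (auto simp: cc)
next
  assume R: ?R
  then have "is_curtain h" by simp
  then obtain I \<alpha> r where c: "curtain_data I \<alpha> r" and h: "h = curtain I \<alpha> r"
    unfolding is_curtain_def by blast
  have out: "x \<notin> h" if "x \<in> A \<union> B" for x
    using R that by (elim conjE) blast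
  note m = mem_curtain_iff[OF c] mem_halfspace_minus_iff[OF c] mem_halfspace_plus_iff[OF c]
  have cc: "connected_component (- h) x y \<longleftrightarrow> (foot I \<alpha> x < r \<longleftrightarrow> foot I \<alpha> y < r)"
    if "x \<in> A \<union> B" "y \<in> A \<union> B" for x y
    using connected_component_curtain_iff[OF c] out[OF that(1)] out[OF that(2)] unfolding h by simp
  have half: "x \<in> halfspace_minus I \<alpha> r \<longleftrightarrow> foot I \<alpha> x < r"
    "x \<in> halfspace_plus I \<alpha> r \<longleftrightarrow> \<not> foot I \<alpha> x < r" if "x \<in> A \<union> B" for x
  proof -
    show "x \<in> halfspace_minus I \<alpha> r \<longleftrightarrow> foot I \<alpha> x < r"
      "x \<in> halfspace_plus I \<alpha> r \<longleftrightarrow> \<not> foot I \<alpha> x < r"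
      using out[OF that] unfolding h m by auto
  qed
  define P where "P x \<longleftrightarrow> foot I \<alpha> x < r" for x
  have R': "\<forall>x\<in>A. \<forall>y\<in>A. connected_component (- h) x y"
    "\<forall>x\<in>B. \<forall>y\<in>B. connected_component (- h) x y"
    "\<forall>x\<in>A. \<forall>y\<in>B. \<not> connected_component (- h) x y"
    using R by blast+
  have "P x = P y" if "x \<in> A" "y \<in> A" for x y
    using bspec[OF bspec[OF R'(1) that(1)] that(2)] cc[of x y] that by (simp add: P_def)
  moreover have "P x = P y" if "x \<in> B" "y \<in> B" for x y
    using bspec[OF bspec[OF R'(2) that(1)] that(2)] cc[of x y] that by (simp add: P_def)
  moreover have "P x \<noteq> P y" if "x \<in> A" "y \<in> B" for x y
    using bspec[OF bspec[OF R'(3) that(1)] that(2)] cc[of x y] that by (simp add: P_def)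
  ultimately have "(\<forall>x\<in>A. P x) \<and> (\<forall>x\<in>B. \<not> P x) \<or> (\<forall>x\<in>B. P x) \<and> (\<forall>x\<in>A. \<not> P x)"
    by metis
  moreover have "S \<subseteq> halfspace_minus I \<alpha> r \<longleftrightarrow> (\<forall>x\<in>S. P x)"
    "S \<subseteq> halfspace_plus I \<alpha> r \<longleftrightarrow> (\<forall>x\<in>S. \<not> P x)" if "S \<subseteq> A \<union> B" for S
    using half that unfolding P_def subset_iff Ball_def by meson+
  ultimately have "A \<subseteq> halfspace_minus I \<alpha> r \<and> B \<subseteq> halfspace_plus I \<alpha> r \<or>
     B \<subseteq> halfspace_minus I \<alpha> r \<and> A \<subseteq> halfspace_plus I \<alpha> r"
    by simp
  then show "separates h A B" using c h unfolding separates_def by blast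
qed

lemma separates_points_iff:
  fixes h :: "'a set"
  shows "separates h {x} {y} \<longleftrightarrow>
    is_curtain h \<and> x \<notin> h \<and> y \<notin> h \<and> \<not> connected_component (- h) x y"
  by (auto simp: separates_iff connected_component_refl)

lemma separates_commute: "separates h A B \<longleftrightarrow> separates h B A"
  unfolding separates_def by blast

lemma curtain_nonempty:
  fixes h :: "'a set"
  assumes "is_curtain h"
  shows "h \<noteq> {}"
proof -
  obtain I \<alpha> r where c: "curtain_data I \<alpha> r" and h: "h = curtain I \<alpha> r"
    using assms unfolding is_curtain_def by blast
  have \<alpha>: "geodesic I \<alpha>" and r: "r \<in> I"
    using c interior_subset[of I] by (auto simp: curtain_data_def subset_iff)
  have "\<alpha> r \<in> h" unfolding h using mem_curtain_iff[OF c] foot_geodesic[OF \<alpha> r] by simp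
  then show ?thesis by blast
qed

lemma connected_curtain:
  fixes h :: "'a set"
  assumes "is_curtain h"
  shows "connected h"
proof -
  obtain I \<alpha> r where c: "curtain_data I \<alpha> r" and h: "h = curtain I \<alpha> r"
    using assms unfolding is_curtain_def by blast
  have \<alpha>: "geodesic I \<alpha>" using c by (simp add: curtain_data_def)
  have "h = {z. foot I \<alpha> z \<in> {r - 1/2..r + 1/2}}" using mem_curtain_iff[OF c] h by blast
  then show ?thesis using connected_foot_vimage[OF \<alpha> is_interval_cc] by simp
qed

lemma connected_closed_side:
  fixes h :: "'a set"
  assumes "is_curtain h" "z \<notin> h"
  shows "connected (h \<union> {u. connected_component (- h) z u})"
proof -
  obtain I \<alpha> r where c: "curtain_data I \<alpha> r" and h: "h = curtain I \<alpha> r"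
    using assms unfolding is_curtain_def by blast
  have \<alpha>: "geodesic I \<alpha>" using c by (simp add: curtain_data_def)
  have cc: "connected_component (- h) z u \<longleftrightarrow> u \<notin> h \<and> (foot I \<alpha> z < r \<longleftrightarrow> foot I \<alpha> u < r)" for u
    using connected_component_curtain_iff[OF c] assms(2) connected_component_in[of "- h" z u]
    unfolding h by blast
  have "h \<union> {u. connected_component (- h) z u} =
    {u. foot I \<alpha> u \<in> (if foot I \<alpha> z < r then {..r + 1/2} else {r - 1/2..})}"
  proof (rule Set.set_eqI)
    fix u
    have "u \<in> h \<longleftrightarrow> foot I \<alpha> u \<in> {r - 1/2..r + 1/2}" using mem_curtain_iff[OF c] h by simp
    then show "u \<in> h \<union> {u. connected_component (- h) z u} \<longleftrightarrow>
      u \<in> {u. foot I \<alpha> u \<in> (if foot I \<alpha> z < r then {..r + 1/2} else {r - 1/2..})}"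
      unfolding Un_iff mem_Collect_eq cc by auto
  qed
  moreover have "is_interval (if foot I \<alpha> z < r then {..r + 1/2} else {r - 1/2..})"
    by (simp add: is_interval_ic is_interval_ci)
  ultimately show ?thesis using connected_foot_vimage[OF \<alpha>] by simp
qed

lemma separating_curtain_meets:
  fixes h :: "'a set"
  assumes "separates h {x} {y}" "connected C" "x \<in> C" "y \<in> C"
  obtains z where "z \<in> C" "z \<in> h"
  using assms unfolding separates_points_iff connected_component_def by blast

section \<open>Chains\<close>

text \<open>The union of \<open>k\<close> and its side containing \<open>z\<close> is connected and avoids \<open>h\<close>, which lies on the
  other side of \<open>k\<close>.\<close>

lemma far_curtain_same_side:
  fixes h k :: "'a set"
  assumes k: "is_curtain k" and disj: "h \<inter> k = {}" and z: "z \<notin> k"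
    and far: "\<And>y. y \<in> h \<Longrightarrow> \<not> connected_component (- k) z y" and y: "y \<in> k"
  shows "connected_component (- h) z y"
  unfolding connected_component_def
  using connected_closed_side[OF k z] disj far z y
  by (intro exI[of _ "k \<union> {u. connected_component (- k) z u}"])
    (auto simp: connected_component_refl)

context
  fixes J :: "int set" and h :: "int \<Rightarrow> 'a set"
  assumes J: "\<And>i j. i \<in> J \<Longrightarrow> j \<in> J \<Longrightarrow> {i..j} \<subseteq> J"
    and curt: "\<And>i. i \<in> J \<Longrightarrow> is_curtain (h i)"
    and disj: "\<And>i j. i \<in> J \<Longrightarrow> j \<in> J \<Longrightarrow> i \<noteq> j \<Longrightarrow> h i \<inter> h j = {}"
    and sep: "\<And>i. i - 1 \<in> J \<Longrightarrow> i \<in> J \<Longrightarrow> i + 1 \<in> J \<Longrightarrow> separates (h i) (h (i - 1)) (h (i + 1))"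
begin

text \<open>The chain condition only relates neighbours. Here all later members are shown to lie on one side of
  \<open>h i\<close>, and all earlier ones on one side of \<open>h k\<close>. Both claims are proved in one induction on the
  distance of the indices: to carry \<open>h (k + 1)\<close> back through \<open>h k\<close> without meeting \<open>h i\<close> one
  needs to know that \<open>h i\<close> lies beyond \<open>h k\<close>, which is the other claim for a smaller distance.\<close>

lemma chain_one_side:
  assumes "i \<in> J" "i + 1 + int n \<in> J"
  shows "(\<forall>x\<in>h (i + 1). \<forall>y\<in>h (i + 1 + int n). connected_component (- h i) x y) \<and>
    (\<forall>x\<in>h (i + int n). \<forall>y\<in>h i. connected_component (- h (i + 1 + int n)) x y)"
  using assms
proof (induction n arbitrary: i)
  case 0
  have same: "connected_component (- h j) x y"
    if "i \<in> J" "j \<in> J" "i \<noteq> j" "x \<in> h i" "y \<in> h i" for i j x y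
    unfolding connected_component_def using connected_curtain[OF curt[OF that(1)]] disj[OF that(1-3)] that
    by blast
  show ?case using same[of "i + 1" i] same[of i "i + 1"] 0 by simp
next
  case (Suc n)
  define k where "k = i + 1 + int n"
  have idx: "i + 1 + int (Suc n) = k + 1" "i + int (Suc n) = k" "i + 1 + 1 + int n = k + 1"
    "i + 1 + int n = k" by (auto simp: k_def)
  have in_J: "i \<in> J" "i + 1 \<in> J" "k \<in> J" "k + 1 \<in> J" "k - 1 \<in> J" "i + 2 \<in> J"
    using Suc.prems J[of i "k + 1"] by (auto simp: k_def subset_iff)
  have IH1: "\<And>x y. x \<in> h (i + 1) \<Longrightarrow> y \<in> h k \<Longrightarrow> connected_component (- h i) x y"
    "\<And>x y. x \<in> h (k - 1) \<Longrightarrow> y \<in> h i \<Longrightarrow> connected_component (- h k) x y"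
    using Suc.IH[of i] in_J by (auto simp: k_def)
  have IH2: "\<And>x y. x \<in> h (i + 2) \<Longrightarrow> y \<in> h (k + 1) \<Longrightarrow> connected_component (- h (i + 1)) x y"
    "\<And>x y. x \<in> h k \<Longrightarrow> y \<in> h (i + 1) \<Longrightarrow> connected_component (- h (k + 1)) x y"
    using Suc.IH[of "i + 1"] in_J by (auto simp: k_def add.assoc add.commute add.left_commute)
  have ik: "i \<noteq> k" "i + 1 \<noteq> k + 1" by (auto simp: k_def)
  have ne: "\<And>j. j \<in> J \<Longrightarrow> h j \<noteq> {}" using curtain_nonempty curt by blast
  have forward: "connected_component (- h i) x z" if x: "x \<in> h (i + 1)" and z: "z \<in> h (k + 1)" for x z
  proof -
    obtain y p where y: "y \<in> h k" and p: "p \<in> h (k - 1)" using ne in_J by blast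
    have "\<not> connected_component (- h k) z q" if q: "q \<in> h i" for q
    proof
      assume "connected_component (- h k) z q"
      from connected_component_trans[OF IH1(2)[OF p q] connected_component_sym[OF this]]
      show False using sep[of k] in_J p z unfolding separates_iff by blast
    qed
    then have "connected_component (- h i) z y"
      using far_curtain_same_side[OF curt[OF in_J(3)] disj[OF in_J(1,3) ik(1)], of z y] y z
        disj[OF in_J(3,4)] by auto
    then show ?thesis
      using connected_component_trans[OF IH1(1)[OF x y]] connected_component_sym by metis
  qed
  have backward: "connected_component (- h (k + 1)) x z" if x: "x \<in> h k" and z: "z \<in> h i" for x z
  proof -
    obtain y p where y: "y \<in> h (i + 1)" and p: "p \<in> h (i + 2)" using ne in_J by blast
    have s: "separates (h (i + 1)) (h i) (h (i + 2))"
      using sep[of "i + 1"] in_J by (simp add: add.assoc)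
    have "\<not> connected_component (- h (i + 1)) z q" if q: "q \<in> h (k + 1)" for q
    proof
      assume "connected_component (- h (i + 1)) z q"
      from connected_component_trans[OF this connected_component_sym[OF IH2(1)[OF p q]]]
      show False using s p z unfolding separates_iff by blast
    qed
    then have "connected_component (- h (k + 1)) z y"
      using far_curtain_same_side[OF curt[OF in_J(2)] disj[OF in_J(4,2) ik(2)[symmetric]], of z y] y z
        disj[OF in_J(1,2)] by auto
    then show ?thesis
      using connected_component_trans[OF IH2(2)[OF x y]] connected_component_sym by metis
  qed
  show ?case unfolding idx using forward backward by blast
qed

lemma chain_between:
  assumes "i \<in> J" "k \<in> J" "i < j" "j < k" "x \<in> h i" "y \<in> h k"
  shows "\<not> connected_component (- h j) x y"
proof
  assume xy: "connected_component (- h j) x y"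
  have in_J: "j \<in> J" "j - 1 \<in> J" "j + 1 \<in> J" using J[of i k] assms by auto
  obtain p q where pq: "p \<in> h (j - 1)" "q \<in> h (j + 1)"
    using curtain_nonempty[OF curt[OF in_J(2)]] curtain_nonempty[OF curt[OF in_J(3)]] by blast
  have "connected_component (- h j) q y"
    using chain_one_side[of j "nat (k - j - 1)"] in_J assms pq by simp
  moreover have "connected_component (- h j) p x"
    using chain_one_side[of i "nat (j - i - 1)"] in_J assms pq by simp
  ultimately have "connected_component (- h j) p q"
    using connected_component_trans[OF connected_component_trans[OF _ xy]]
      connected_component_sym[of "- h j" q y] by blast
  then show False using sep[of j] in_J pq unfolding separates_iff by blast
qed

text \<open>If \<open>h j\<close> does not separate \<open>x\<close> from \<open>y\<close>, both points lie in the union of \<open>h j\<close> with one of its sides.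
  That union is connected and, by the order of the chain, misses \<open>h i\<close> or \<open>h k\<close>, which therefore does
  not separate \<open>x\<close> from \<open>y\<close> either.\<close>

lemma chain_separates_between:
  assumes "i \<in> J" "k \<in> J" "i < j" "j < k" "separates (h i) {x} {y}" "separates (h k) {x} {y}"
  shows "separates (h j) {x} {y}"
proof (rule ccontr)
  assume no: "\<not> separates (h j) {x} {y}"
  have j: "j \<in> J" using J[of i k] assms by auto
  let ?side = "\<lambda>p. h j \<union> {u. connected_component (- h j) p u}"
  obtain p q where p: "p \<in> h i" and q: "q \<in> h k"
    using curtain_nonempty[OF curt[OF assms(1)]] curtain_nonempty[OF curt[OF assms(2)]] by blast
  have d: "h i \<inter> h j = {}" "h k \<inter> h j = {}" using disj[of i j] disj[of k j] assms j by auto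
  have pj: "p \<notin> h j" "q \<notin> h j" using d p q by auto
  have npq: "\<And>p q. p \<in> h i \<Longrightarrow> q \<in> h k \<Longrightarrow> \<not> connected_component (- h j) p q"
    using chain_between[OF assms(1-4)] .
  have cov: "u \<in> ?side p \<or> u \<in> ?side q" for u
    using curtain_two_sides[OF curt[OF j] pj, of u] npq[OF p q] by blast
  have i: "?side q \<inter> h i = {}" and k: "?side p \<inter> h k = {}"
    using npq[OF _ q] npq[OF p] d connected_component_sym[of "- h j" q] by blast+
  have nbi: "\<not> (x \<in> ?side q \<and> y \<in> ?side q)"
    using separating_curtain_meets[OF assms(5) connected_closed_side[OF curt[OF j] pj(2)]] i by blast
  have nbk: "\<not> (x \<in> ?side p \<and> y \<in> ?side p)"
    using separating_curtain_meets[OF assms(6) connected_closed_side[OF curt[OF j] pj(1)]] k by blast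
  have out: "x \<notin> h j" "y \<notin> h j" using nbi nbk cov by blast+
  have "connected_component (- h j) x y" using no out curt[OF j] by (simp add: separates_points_iff)
  then show False
    using nbi nbk cov[of x] cov[of y] out connected_component_trans[of "- h j" p x y]
      connected_component_trans[of "- h j" q x y] by blast
qed

end


text \<open>Chains are indexed by consecutive integers, so a subset of a chain is a chain only after its
  indices are known to be consecutive. For the members that separate two points this is the
  previous lemma.\<close>

lemma L_chain_separating_subset:
  fixes c :: "'a set set"
  assumes "L_chain L c"
  shows "L_chain L {h \<in> c. separates h {x} {y}}"
proof -
  let ?c = "{h \<in> c. separates h {x} {y}}"
  obtain J :: "int set" and h where J: "\<forall>i\<in>J. \<forall>j\<in>J. {i..j} \<subseteq> J" and bij: "bij_betw h J c"
    and sep: "\<forall>i. i - 1 \<in> J \<and> i \<in> J \<and> i + 1 \<in> J \<longrightarrow> separates (h i) (h (i - 1)) (h (i + 1))"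
    and curt: "\<forall>h\<in>c. is_curtain h" and pw: "pairwise (L_separated L) c"
    using assms unfolding L_chain_def chain_def by blast
  have hJ: "h i \<in> c" if "i \<in> J" for i using bij that by (rule bij_betw_apply)
  have disj: "h i \<inter> h j = {}" if "i \<in> J" "j \<in> J" "i \<noteq> j" for i j
  proof -
    have "h i \<noteq> h j" using inj_onD[OF bij_betw_imp_inj_on[OF bij] _ that(1,2)] that(3) by blast
    then have "L_separated L (h i) (h j)" using pairwiseD[OF pw hJ[OF that(1)] hJ[OF that(2)]] by simp
    then show ?thesis by (simp add: L_separated_def)
  qed
  define J' where "J' = {i \<in> J. separates (h i) {x} {y}}"
  have int: "{i..k} \<subseteq> J'" if ik: "i \<in> J'" "k \<in> J'" for i k
  proof
    fix j assume j: "j \<in> {i..k}"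
    have iJ: "i \<in> J" "k \<in> J" "separates (h i) {x} {y}" "separates (h k) {x} {y}"
      using ik by (auto simp: J'_def)
    have jJ: "j \<in> J" using J iJ j by blast
    show "j \<in> J'"
    proof (cases "j = i \<or> j = k")
      case False
      then have "i < j" "j < k" using j by auto
      then have "separates (h j) {x} {y}"
        using chain_separates_between[of J h i k j x y] J curt disj sep iJ hJ by simp
      then show ?thesis using jJ by (simp add: J'_def)
    qed (use ik in auto)
  qed
  have im: "h ` J' = ?c"
    using bij_betw_imp_surj_on[OF bij] unfolding J'_def by blast
  have "inj_on h J'"
    by (rule inj_on_subset[OF bij_betw_imp_inj_on[OF bij]]) (simp add: J'_def)
  then have bij': "bij_betw h J' ?c" using im by (simp add: bij_betw_def)
  have sub: "J' \<subseteq> J" by (auto simp: J'_def)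
  have "chain ?c"
    unfolding chain_def
  proof (intro conjI exI[of _ J'] exI[of _ h])
    show "\<forall>i\<in>J'. \<forall>j\<in>J'. {i..j} \<subseteq> J'" using int by simp
    show "\<forall>i. i - 1 \<in> J' \<and> i \<in> J' \<and> i + 1 \<in> J' \<longrightarrow> separates (h i) (h (i - 1)) (h (i + 1))"
      using sep sub by (simp add: subset_iff)
  qed (use curt bij' in auto)
  then show ?thesis
    unfolding L_chain_def using pairwise_subset[OF pw] by auto
qed

section \<open>The distances counting separated curtains\<close>

text \<open>At the time \<open>t\<close> when the projection of \<open>\<gamma> t\<close> is the centre \<open>r\<close> of the curtain, the Lipschitz property
  keeps \<open>\<gamma>\<close> inside the curtain for half a unit of time in both directions.\<close>

lemma curtain_crossing_centre:
  fixes \<gamma> :: "real \<Rightarrow> 'a"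
  assumes sep: "separates h {x} {y}" and \<gamma>: "geodesic T \<gamma>" and p: "p \<in> T" "\<gamma> p = x"
    and q: "q \<in> T" "\<gamma> q = y"
  obtains t where "t \<in> T" "\<And>s. s \<in> T \<Longrightarrow> \<bar>s - t\<bar> \<le> 1/2 \<Longrightarrow> \<gamma> s \<in> h"
proof -
  obtain I \<alpha> r where c: "curtain_data I \<alpha> r" and h: "h = curtain I \<alpha> r" and
    "{x} \<subseteq> halfspace_minus I \<alpha> r \<and> {y} \<subseteq> halfspace_plus I \<alpha> r \<or>
     {y} \<subseteq> halfspace_minus I \<alpha> r \<and> {x} \<subseteq> halfspace_plus I \<alpha> r"
    using sep unfolding separates_def by blast
  then have xy: "foot I \<alpha> x \<le> r \<and> r \<le> foot I \<alpha> y \<or> foot I \<alpha> y \<le> r \<and> r \<le> foot I \<alpha> x"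
    by (auto simp: mem_halfspace_minus_iff[OF c] mem_halfspace_plus_iff[OF c])
  have \<alpha>: "geodesic I \<alpha>" using c by (simp add: curtain_data_def)
  have conn: "connected (\<gamma> ` T)"
    using geodesicD(1)[OF \<gamma>]
    by (intro connected_continuous_image geodesic_continuous_on[OF \<gamma>]) (simp add: is_interval_connected)
  have mem: "x \<in> \<gamma> ` T" "y \<in> \<gamma> ` T" using imageI[OF p(1), of \<gamma>] imageI[OF q(1), of \<gamma>] p q by simp_all
  obtain z where "z \<in> \<gamma> ` T" "foot I \<alpha> z = r"
    using xy connected_meets_levels[OF \<alpha> conn mem, of r]
      connected_meets_levels[OF \<alpha> conn mem(2,1), of r] by metis
  then obtain t where t: "t \<in> T" "foot I \<alpha> (\<gamma> t) = r" by blast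
  have "\<gamma> s \<in> h" if s: "s \<in> T" "\<bar>s - t\<bar> \<le> 1/2" for s
    using foot_lipschitz[OF \<alpha>, of "\<gamma> s" "\<gamma> t"] geodesicD(4)[OF \<gamma> s(1) t(1)] s(2) t(2)
    unfolding h mem_curtain_iff[OF c] atLeastAtMost_iff by linarith
  then show ?thesis using that t(1) by blast
qed

text \<open>The crossing centres of disjoint curtains are more than \<open>1/2\<close> apart on the geodesic from \<open>x\<close> to \<open>y\<close>,
  so the integer parts of their doubles are distinct.\<close>

lemma card_separating_curtains_le:
  fixes c :: "'a set set"
  assumes fin: "finite c" and disj: "\<And>h k. h \<in> c \<Longrightarrow> k \<in> c \<Longrightarrow> h \<noteq> k \<Longrightarrow> h \<inter> k = {}"
    and sep: "\<And>h. h \<in> c \<Longrightarrow> separates h {x} {y}"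
  shows "real (card c) \<le> 2 * dist x y + 1"
proof -
  define T where "T = {0..dist x y}"
  obtain \<gamma> where \<gamma>: "geodesic T \<gamma>" "\<gamma> 0 = x" "\<gamma> (dist x y) = y"
    using geodesic_joining_exists unfolding T_def .
  have ends: "0 \<in> T" "dist x y \<in> T" by (auto simp: T_def)
  have "\<exists>t. t \<in> T \<and> (\<forall>s\<in>T. \<bar>s - t\<bar> \<le> 1/2 \<longrightarrow> \<gamma> s \<in> h)" if "h \<in> c" for h
    using curtain_crossing_centre[OF sep[OF that] \<gamma>(1) ends(1) \<gamma>(2) ends(2) \<gamma>(3)] by metis
  then obtain t where t: "\<And>h. h \<in> c \<Longrightarrow> t h \<in> T"
    "\<And>h s. h \<in> c \<Longrightarrow> s \<in> T \<Longrightarrow> \<bar>s - t h\<bar> \<le> 1/2 \<Longrightarrow> \<gamma> s \<in> h"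
    by metis
  have inj: "inj_on (\<lambda>h. \<lfloor>2 * t h\<rfloor>) c"
  proof (rule inj_onI, rule ccontr)
    fix h k assume hk: "h \<in> c" "k \<in> c" "\<lfloor>2 * t h\<rfloor> = \<lfloor>2 * t k\<rfloor>" "h \<noteq> k"
    then have "\<bar>t k - t h\<bar> \<le> 1/2" by linarith
    then have "\<gamma> (t k) \<in> h" "\<gamma> (t k) \<in> k" using t hk by auto
    then show False using disj[OF hk(1,2,4)] by blast
  qed
  have "(\<lambda>h. \<lfloor>2 * t h\<rfloor>) ` c \<subseteq> {0..\<lfloor>2 * dist x y\<rfloor>}"
    using t(1) by (auto simp: T_def intro!: floor_mono)
  then have "card c \<le> card {0..\<lfloor>2 * dist x y\<rfloor>}"
    by (rule card_inj_on_le[OF inj]) simp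
  then have "card c \<le> nat (\<lfloor>2 * dist x y\<rfloor> + 1)" by simp
  then have "real (card c) \<le> real (nat (\<lfloor>2 * dist x y\<rfloor> + 1))" by (simp only: of_nat_le_iff)
  also have "\<dots> \<le> 2 * dist x y + 1"
    using zero_le_dist[of x y] by linarith
  finally show ?thesis .
qed

lemma L_chain_disjoint: "L_chain L c \<Longrightarrow> h \<in> c \<Longrightarrow> k \<in> c \<Longrightarrow> h \<noteq> k \<Longrightarrow> h \<inter> k = {}"
  unfolding L_chain_def pairwise_def L_separated_def by blast

text \<open>An infinite set has cardinality 0, so the bound holds for every chain and the
  maximum in the definition of \<open>dist_L\<close> is over a finite set of numbers.\<close>

lemma L_chain_card_le:
  fixes c :: "'a set set"
  assumes "L_chain L c" "chain_separates c {x} {y}"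
  shows "real (card c) \<le> 2 * dist x y + 1"
proof (cases "finite c")
  case True
  then show ?thesis
    using card_separating_curtains_le[OF True L_chain_disjoint[OF assms(1)]] assms(2)
    by (simp add: chain_separates_def)
qed simp

lemma
  fixes x y :: 'a
  assumes xy: "x \<noteq> y"
  shows L_chain_card_less_dist_L:
      "L_chain L c \<Longrightarrow> chain_separates c {x} {y} \<Longrightarrow> card c < dist_L L x y"
    and dist_L_attained:
      "\<exists>c. L_chain L c \<and> chain_separates c {x} {y} \<and> dist_L L x y = 1 + card c"
proof -
  let ?S = "{card c | c. L_chain L c \<and> chain_separates c {x} {y}}"
  have "?S \<subseteq> {..nat \<lfloor>2 * dist x y + 1\<rfloor>}"
  proof
    fix m assume "m \<in> ?S"
    then have "real m \<le> 2 * dist x y + 1" using L_chain_card_le by auto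
    then show "m \<in> {..nat \<lfloor>2 * dist x y + 1\<rfloor>}"
      unfolding atMost_iff by (rule le_nat_floor)
  qed
  then have fin: "finite ?S" using finite_subset by blast
  have "chain ({} :: 'a set set)" unfolding chain_def
    by (intro conjI exI[of _ "{} :: int set"] exI[of _ "\<lambda>_. {}"]) (auto simp: bij_betw_def)
  then have "L_chain L ({} :: 'a set set)" "chain_separates {} {x} {y}"
    by (auto simp: L_chain_def chain_separates_def)
  then have ne: "?S \<noteq> {}" by blast
  show "card c < dist_L L x y" if "L_chain L c" "chain_separates c {x} {y}"
    using Max_ge[OF fin, of "card c"] that xy by (auto simp: dist_L_def less_Suc_eq_le)
  show "\<exists>c. L_chain L c \<and> chain_separates c {x} {y} \<and> dist_L L x y = 1 + card c"
    using Max_in[OF fin ne] xy by (auto simp: dist_L_def)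
qed

lemma dist_L_le:
  fixes x y :: 'a
  shows "real (dist_L L x y) \<le> 2 * dist x y + 2"
proof (cases "x = y")
  case False
  then obtain c where "L_chain L c" "chain_separates c {x} {y}" "dist_L L x y = 1 + card c"
    using dist_L_attained by blast
  then show ?thesis using L_chain_card_le[of L c x y] by simp
qed (simp add: dist_L_def)

lemma card_separating_subset_le_dist_L:
  fixes c :: "'a set set"
  assumes "L_chain L c"
  shows "card {h \<in> c. separates h {x} {y}} \<le> dist_L L x y"
proof (cases "x = y")
  case True
  then have "{h \<in> c. separates h {x} {y}} = {}"
    by (auto simp: separates_points_iff connected_component_refl)
  then show ?thesis by (simp only: card.empty)
next
  case False
  have "chain_separates {h \<in> c. separates h {x} {y}} {x} {y}" by (simp add: chain_separates_def)
  then show ?thesis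
    using L_chain_card_less_dist_L[OF False L_chain_separating_subset[OF assms]] by (simp add: less_imp_le)
qed

lemma dist_L_commute: "dist_L L x y = dist_L L y x"
proof -
  have "chain_separates c {x} {y} \<longleftrightarrow> chain_separates c {y} {x}" for c
    unfolding chain_separates_def by (subst separates_commute) simp
  then show ?thesis unfolding dist_L_def by auto
qed

lemma card_curtains_through_point_le:
  fixes c :: "'a set set"
  assumes "L_chain L c" "finite c"
  shows "card {h \<in> c. z \<in> h} \<le> 1"
proof -
  have "\<forall>h\<in>{h \<in> c. z \<in> h}. \<forall>k\<in>{h \<in> c. z \<in> h}. h = k"
    using L_chain_disjoint[OF assms(1)] by blast
  then show ?thesis using card_le_Suc0_iff_eq[of "{h \<in> c. z \<in> h}"] assms(2) by simp
qed

text \<open>A curtain that separates \<open>x\<close> from \<open>z\<close> separates \<open>x\<close> from \<open>y\<close>, or \<open>y\<close> from \<open>z\<close>, or contains \<open>y\<close>. The last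
  happens for at most one member of an \<open>L\<close>-chain and is absorbed by the summand 1 in \<open>dist_L\<close>.\<close>

lemma dist_L_triangle:
  fixes x y z :: 'a
  shows "dist_L L x z \<le> dist_L L x y + dist_L L y z"
proof (cases "x = y \<or> y = z \<or> x = z")
  case True
  then show ?thesis by (auto simp: dist_L_def)
next
  case False
  then obtain c where c: "L_chain L c" "chain_separates c {x} {z}" "dist_L L x z = 1 + card c"
    using dist_L_attained[of x z L] by blast
  let ?A = "{h \<in> c. separates h {x} {y}}" and ?B = "{h \<in> c. separates h {y} {z}}"
  show ?thesis
  proof (cases "finite c")
    case fin: True
    have "h \<in> ?A \<union> ?B \<union> {h \<in> c. y \<in> h}" if h: "h \<in> c" for h
    proof -
      have "separates h {x} {z}" using c(2) h by (simp add: chain_separates_def)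
      then show ?thesis
        using h connected_component_trans[of "- h" x y z] by (auto simp: separates_points_iff)
    qed
    then have "card c \<le> card (?A \<union> ?B \<union> {h \<in> c. y \<in> h})"
      using fin by (intro card_mono) auto
    also have "\<dots> \<le> card ?A + card ?B + card {h \<in> c. y \<in> h}"
      by (intro order_trans[OF card_Un_le] add_right_mono card_Un_le)
    finally have "card c \<le> card ?A + card ?B + 1"
      using card_curtains_through_point_le[OF c(1) fin, of y] by linarith
    moreover have "card ?A < dist_L L x y" "card ?B < dist_L L y z"
      using False L_chain_card_less_dist_L[OF _ L_chain_separating_subset[OF c(1)]]
      by (auto simp: chain_separates_def)
    ultimately show ?thesis using c(3) by linarith
  next
    case inf: False
    then show ?thesis using c(3) False by (simp add: dist_L_def)
  qed
qed

section \<open>Separated curtains confine geodesics\<close>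

text \<open>The heart of the argument: two geodesics of length at most \<open>M\<close> that cross the same two
  \<open>L\<close>-separated curtains \<open>h\<close>, \<open>k\<close> cross them close to each other. Consider the geodesic from \<open>u\<close> to \<open>v\<close>. The projections
  of \<open>h\<close> and of \<open>k\<close> to it both reach from the first \<open>M\<close> units to the last \<open>M\<close> units, and both sets
  are connected, so they meet every curtain dual to the part in between. Were that
  part long enough, there would be \<open>L + 1\<close> such curtains.\<close>

lemma L_separated_crossings_close:
  fixes h k :: "'a set"
  assumes sep: "L_separated L h k"
    and h: "u \<in> h" "v \<in> h" and k: "u' \<in> k" "v' \<in> k"
    and M: "dist u u' \<le> M" "dist v v' \<le> M"
  shows "dist u v \<le> 2 * M + 2 * real L + 3"
proof (rule ccontr)
  assume "\<not> ?thesis"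
  then have big: "2 * M + 2 * real L + 3 < dist u v" by simp
  have M0: "0 \<le> M" using M(1) zero_le_dist[of u u'] by linarith
  define I where "I = {0..dist u v}"
  obtain \<alpha> where \<alpha>: "geodesic I \<alpha>" "\<alpha> 0 = u" "\<alpha> (dist u v) = v"
    using geodesic_joining_exists unfolding I_def .
  have fu: "foot I \<alpha> u = 0" and fv: "foot I \<alpha> v = dist u v"
    using foot_geodesic[OF \<alpha>(1), of 0] foot_geodesic[OF \<alpha>(1), of "dist u v"] \<alpha>(2,3)
    by (simp_all add: I_def)
  have fu': "foot I \<alpha> u' \<le> M" and fv': "dist u v - M \<le> foot I \<alpha> v'"
    using foot_lipschitz[OF \<alpha>(1), of u u'] foot_lipschitz[OF \<alpha>(1), of v v'] fu fv M by linarith+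
  define J where "J = {1..int L + 1}"
  \<comment> \<open>Curtains have width 1; with centres 2 apart they are disjoint and form a chain.\<close>
  define r where "r i = M + 2 * real_of_int i" for i
  define f where "f i = curtain I \<alpha> (r i)" for i
  have rb: "M + 3/2 \<le> r i - 1/2" "r i + 1/2 \<le> M + 2 * real L + 5/2" if "i \<in> J" for i
  proof -
    have "1 \<le> real_of_int i" "real_of_int i \<le> real L + 1"
      using that by (auto simp: J_def)
    then show "M + 3/2 \<le> r i - 1/2" "r i + 1/2 \<le> M + 2 * real L + 5/2" by (auto simp: r_def)
  qed
  have cd: "curtain_data I \<alpha> (r i)" if "i \<in> J" for i
    unfolding curtain_data_def using \<alpha>(1) rb[OF that] big M0 by (auto simp: I_def)
  have mem: "z \<in> f i \<longleftrightarrow> foot I \<alpha> z \<in> {r i - 1/2..r i + 1/2}" if "i \<in> J" for z i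
    unfolding f_def using mem_curtain_iff[OF cd[OF that]] .
  have curt: "is_curtain (f i)" if "i \<in> J" for i
    using cd[OF that] unfolding is_curtain_def f_def by blast
  have inj: "inj_on f J"
  proof (rule inj_onI)
    fix i j assume ij: "i \<in> J" "j \<in> J" "f i = f j"
    obtain z where z: "z \<in> f i" using curtain_nonempty[OF curt[OF ij(1)]] by blast
    then have "\<bar>r i - r j\<bar> \<le> 1" using mem[OF ij(1), of z] mem[OF ij(2), of z] ij(3) by auto
    then have "\<bar>2 * real_of_int i - 2 * real_of_int j\<bar> \<le> 1" by (simp add: r_def)
    then show "i = j" by linarith
  qed
  have "separates (f i) (f (i - 1)) (f (i + 1))" if i: "i - 1 \<in> J" "i \<in> J" "i + 1 \<in> J" for i
    unfolding separates_def
  proof (intro exI conjI disjI1)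
    show "f (i - 1) \<subseteq> halfspace_minus I \<alpha> (r i)"
      unfolding subset_iff mem[OF i(1)] mem_halfspace_minus_iff[OF cd[OF i(2)]] by (auto simp: r_def)
    show "f (i + 1) \<subseteq> halfspace_plus I \<alpha> (r i)"
      unfolding subset_iff mem[OF i(3)] mem_halfspace_plus_iff[OF cd[OF i(2)]] by (auto simp: r_def)
  qed (use cd[OF i(2)] f_def in auto)
  then have "chain (f ` J)"
    unfolding chain_def using curt inj_on_imp_bij_betw[OF inj]
    by (intro conjI exI[of _ J] exI[of _ f]) (auto simp: J_def)
  moreover have meets: "f i \<inter> S \<noteq> {}"
    if i: "i \<in> J" and S: "connected S" "p \<in> S" "q \<in> S" "foot I \<alpha> p \<le> M" "dist u v - M \<le> foot I \<alpha> q"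
    for i S p q
  proof -
    obtain z where "z \<in> S" "foot I \<alpha> z = r i"
      by (rule connected_meets_levels[OF \<alpha>(1) S(1-3), of "r i"]) (use rb[OF i] S(4,5) big in auto)
    then show ?thesis using mem[OF i, of z] by auto
  qed
  have ch: "is_curtain h" "is_curtain k" using sep by (simp_all add: L_separated_def)
  have "m \<inter> h \<noteq> {} \<and> m \<inter> k \<noteq> {}" if "m \<in> f ` J" for m
    using that meets[OF _ connected_curtain[OF ch(1)] h] meets[OF _ connected_curtain[OF ch(2)] k]
      fu fv fu' fv' M0 by auto
  ultimately have "card (f ` J) \<le> L" using sep by (simp add: L_separated_def)
  then show False using card_image[OF inj] by (simp add: J_def)
qed

lemma geodesic_crosses_two_curtains:
  fixes a b :: 'a
  assumes "separates h {a} {b}" "separates k {a} {b}"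
  obtains u u' where "u \<in> h" "u' \<in> k" "dist a u \<le> dist a b" "dist u u' \<le> dist a b"
proof -
  define T where "T = {0..dist a b}"
  obtain \<gamma> where \<gamma>: "geodesic T \<gamma>" "\<gamma> 0 = a" "\<gamma> (dist a b) = b"
    using geodesic_joining_exists unfolding T_def .
  have ends: "0 \<in> T" "dist a b \<in> T" by (auto simp: T_def)
  have cross: "\<exists>s\<in>T. \<gamma> s \<in> m" if "separates m {a} {b}" for m
    by (rule curtain_crossing_centre[OF that \<gamma>(1) ends(1) \<gamma>(2) ends(2) \<gamma>(3)])
      (rule bexI[rotated], assumption, simp)
  obtain s where s: "s \<in> T" "\<gamma> s \<in> h" using cross[OF assms(1)] by blast
  obtain t where t: "t \<in> T" "\<gamma> t \<in> k" using cross[OF assms(2)] by blast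
  have d: "dist (\<gamma> p) (\<gamma> q) \<le> dist a b" if "p \<in> T" "q \<in> T" for p q
    using geodesicD(4)[OF \<gamma>(1) that] that by (auto simp: T_def)
  show ?thesis
    using that[OF s(2) t(2)] d[OF ends(1) s(1)] d[OF s(1) t(1)] \<gamma>(2,3) by simp
qed

text \<open>Discard from the chain the curtains separating \<open>a\<close> from \<open>x\<close> or \<open>b\<close> from \<open>y\<close>, of which there are at
  most \<open>dist_L L a x + dist_L L b y\<close>, and those containing \<open>x\<close> or \<open>y\<close>, of which there are at most 2. A remaining
  curtain has \<open>x\<close> on the side of \<open>a\<close> and \<open>y\<close> on the side of \<open>b\<close>.\<close>

lemma exists_two_curtains_separating_both:
  fixes a b x y :: 'a
  assumes c: "L_chain L c" "chain_separates c {a} {b}"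
    and big: "dist_L L a x + dist_L L b y + 4 \<le> card c"
  obtains h k where "L_separated L h k" "separates h {a} {b}" "separates k {a} {b}"
    "separates h {x} {y}" "separates k {x} {y}"
proof -
  have fin: "finite c" using big by (intro card_ge_0_finite) simp
  let ?A = "{h \<in> c. separates h {a} {x}}" and ?B = "{h \<in> c. separates h {b} {y}}"
  let ?X = "{h \<in> c. x \<in> h}" and ?Y = "{h \<in> c. y \<in> h}"
  define c' where "c' = c - (?A \<union> ?B \<union> (?X \<union> ?Y))"
  note one = card_curtains_through_point_le[OF c(1) fin]
  have "card (?A \<union> ?B \<union> (?X \<union> ?Y)) \<le> (card ?A + card ?B) + (card ?X + card ?Y)"
    by (intro order_trans[OF card_Un_le] add_mono card_Un_le)
  also have "\<dots> \<le> dist_L L a x + dist_L L b y + 2"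
    using card_separating_subset_le_dist_L[OF c(1), of a x]
      card_separating_subset_le_dist_L[OF c(1), of b y] one[of x] one[of y] by linarith
  finally have "card (?A \<union> ?B \<union> (?X \<union> ?Y)) \<le> dist_L L a x + dist_L L b y + 2" .
  then have "\<not> card c' \<le> Suc 0"
    using diff_card_le_card_Diff[of "?A \<union> ?B \<union> (?X \<union> ?Y)" c] fin big by (simp add: c'_def)
  then obtain h k where hk: "h \<in> c'" "k \<in> c'" "h \<noteq> k"
    using card_le_Suc0_iff_eq[of c'] fin by (auto simp: c'_def)
  have sab: "separates h {a} {b}" if "h \<in> c'" for h
    using that c(2) by (auto simp: c'_def chain_separates_def)
  have sxy: "separates h {x} {y}" if "h \<in> c'" for h
  proof -
    have h: "is_curtain h" "a \<notin> h" "b \<notin> h" "\<not> connected_component (- h) a b"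
      using sab[OF that] by (simp_all add: separates_points_iff)
    have xy: "x \<notin> h" "y \<notin> h" "\<not> separates h {a} {x}" "\<not> separates h {b} {y}"
      using that by (auto simp: c'_def)
    have ax: "connected_component (- h) a x" and b: "connected_component (- h) y b"
      using h xy connected_component_sym[of "- h" b y] by (auto simp: separates_points_iff)
    have "\<not> connected_component (- h) x y"
      using connected_component_trans[OF connected_component_trans[OF ax] b] h(4) by blast
    then show ?thesis using h xy by (simp add: separates_points_iff)
  qed
  have "L_separated L h k"
    using hk c(1) pairwiseD[of "L_separated L" c h k] by (auto simp: L_chain_def c'_def)
  then show ?thesis using that sab sxy hk by blast
qed

text \<open>The geodesics \<open>[a,b]\<close> and \<open>[x,y]\<close> cross one of the two curtains in points close to each other, and
  these points are within \<open>d(a,b)\<close> of \<open>a\<close> and of \<open>x\<close>. The summand 5 consists of the 4 of the previous lemma, two curtains to keep and two that may contain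
  \<open>x\<close> or \<open>y\<close>, and the 1 in the definition of \<open>dist_L\<close>.\<close>

lemma dist_le_if_L_distance_survives:
  fixes a b x y :: 'a
  assumes big: "dist_L L a x + dist_L L b y + 5 \<le> dist_L L a b" and xy: "dist x y \<le> dist a b"
  shows "dist a x \<le> 4 * dist a b + 2 * real L + 3"
proof -
  have "a \<noteq> b" using big by (auto simp: dist_L_def)
  then obtain c where c: "L_chain L c" "chain_separates c {a} {b}" "dist_L L a b = 1 + card c"
    using dist_L_attained by blast
  obtain h k where hk: "L_separated L h k" "separates h {a} {b}" "separates k {a} {b}"
    "separates h {x} {y}" "separates k {x} {y}"
    by (rule exists_two_curtains_separating_both[OF c(1,2), of x y]) (use big c(3) in auto)
  obtain u u' where u: "u \<in> h" "u' \<in> k" "dist a u \<le> dist a b" "dist u u' \<le> dist a b"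
    using geodesic_crosses_two_curtains[OF hk(2,3)] by metis
  obtain v v' where v: "v \<in> h" "v' \<in> k" "dist x v \<le> dist x y" "dist v v' \<le> dist x y"
    using geodesic_crosses_two_curtains[OF hk(4,5)] by metis
  have "dist u v \<le> 2 * dist a b + 2 * real L + 3"
    using L_separated_crossings_close[OF hk(1) u(1) v(1) u(2) v(2), of "dist a b"] u v xy by linarith
  then show ?thesis
    using u v xy dist_triangle[of a x u] dist_triangle[of u x v] dist_commute[of v x] by linarith
qed

section \<open>Isometry invariance\<close>

context
  fixes f g :: "'a \<Rightarrow> 'a"
  assumes iso: "\<And>x y. dist (f x) (f y) = dist x y"
    and fg: "\<And>x. f (g x) = x" and gf: "\<And>x. g (f x) = x"
begin

lemma
  fixes \<alpha> :: "real \<Rightarrow> 'a"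
  assumes c: "curtain_data I \<alpha> r"
  shows curtain_data_isometry: "curtain_data I (f \<circ> \<alpha>) r"
    and curtain_isometry: "curtain I (f \<circ> \<alpha>) r = f ` curtain I \<alpha> r"
    and halfspace_minus_isometry: "halfspace_minus I (f \<circ> \<alpha>) r = f ` halfspace_minus I \<alpha> r"
    and halfspace_plus_isometry: "halfspace_plus I (f \<circ> \<alpha>) r = f ` halfspace_plus I \<alpha> r"
proof -
  have \<alpha>: "geodesic I \<alpha>" using c by (simp add: curtain_data_def)
  show c': "curtain_data I (f \<circ> \<alpha>) r"
    using c foot_isometry(1)[OF \<alpha> iso] by (simp add: curtain_data_def)
  have ft: "foot I (f \<circ> \<alpha>) z = foot I \<alpha> (g z)" for z
    using foot_isometry(2)[OF \<alpha> iso, of "g z"] by (simp add: fg)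
  have im: "z \<in> f ` S \<longleftrightarrow> g z \<in> S" for z S
    using fg[of z] gf by (metis image_iff)
  show "curtain I (f \<circ> \<alpha>) r = f ` curtain I \<alpha> r"
    "halfspace_minus I (f \<circ> \<alpha>) r = f ` halfspace_minus I \<alpha> r"
    "halfspace_plus I (f \<circ> \<alpha>) r = f ` halfspace_plus I \<alpha> r"
    by (rule Set.set_eqI, simp only: im ft mem_curtain_iff[OF c] mem_curtain_iff[OF c']
        mem_halfspace_minus_iff[OF c] mem_halfspace_minus_iff[OF c']
        mem_halfspace_plus_iff[OF c] mem_halfspace_plus_iff[OF c'])+
qed

lemma is_curtain_isometry:
  assumes "is_curtain h" shows "is_curtain (f ` h)"
proof -
  obtain I \<alpha> r where c: "curtain_data I \<alpha> r" and h: "h = curtain I \<alpha> r"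
    using assms unfolding is_curtain_def by blast
  show ?thesis
    unfolding is_curtain_def h
    by (intro exI conjI) (rule curtain_data_isometry[OF c], rule curtain_isometry[OF c, symmetric])
qed

lemma separates_isometry:
  assumes "separates h A B" shows "separates (f ` h) (f ` A) (f ` B)"
proof -
  obtain I \<alpha> r where c: "curtain_data I \<alpha> r" and h: "h = curtain I \<alpha> r" and
    AB: "A \<subseteq> halfspace_minus I \<alpha> r \<and> B \<subseteq> halfspace_plus I \<alpha> r \<or>
     B \<subseteq> halfspace_minus I \<alpha> r \<and> A \<subseteq> halfspace_plus I \<alpha> r"
    using assms unfolding separates_def by blast
  show ?thesis
    unfolding separates_def
  proof (intro exI conjI)
    show "curtain_data I (f \<circ> \<alpha>) r" using curtain_data_isometry[OF c] .
    show "f ` h = curtain I (f \<circ> \<alpha>) r" using curtain_isometry[OF c] h by simp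
    show "f ` A \<subseteq> halfspace_minus I (f \<circ> \<alpha>) r \<and> f ` B \<subseteq> halfspace_plus I (f \<circ> \<alpha>) r \<or>
     f ` B \<subseteq> halfspace_minus I (f \<circ> \<alpha>) r \<and> f ` A \<subseteq> halfspace_plus I (f \<circ> \<alpha>) r"
      unfolding halfspace_minus_isometry[OF c] halfspace_plus_isometry[OF c]
      using AB image_mono by metis
  qed
qed

lemma inj_image_isometry: "inj ((`) f)"
  by (rule inj_on_inverseI[of _ "(`) g"]) (simp add: image_image gf)

lemma chain_isometry:
  assumes "chain c" shows "chain ((`) f ` c)"
proof -
  obtain J :: "int set" and h where J: "\<forall>i\<in>J. \<forall>j\<in>J. {i..j} \<subseteq> J" and bij: "bij_betw h J c"
    and sep: "\<forall>i. i - 1 \<in> J \<and> i \<in> J \<and> i + 1 \<in> J \<longrightarrow> separates (h i) (h (i - 1)) (h (i + 1))"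
    and curt: "\<forall>h\<in>c. is_curtain h"
    using assms unfolding chain_def by blast
  have "bij_betw ((`) f \<circ> h) J ((`) f ` c)"
    using bij inj_on_imp_bij_betw[OF inj_on_subset[OF inj_image_isometry subset_UNIV]]
    by (rule bij_betw_trans)
  then show ?thesis
    unfolding chain_def using J sep curt is_curtain_isometry separates_isometry
    by (intro conjI exI[of _ J] exI[of _ "(`) f \<circ> h"]) simp_all
qed

end

text \<open>A chain whose members meet \<open>f ` h\<close> and \<open>f ` k\<close> is pulled back by the inverse isometry to one whose
  members meet \<open>h\<close> and \<open>k\<close>.\<close>

lemma L_separated_isometry:
  fixes f g :: "'a \<Rightarrow> 'a"
  assumes iso: "\<And>x y. dist (f x) (f y) = dist x y"
    and fg: "\<And>x. f (g x) = x" and gf: "\<And>x. g (f x) = x"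
    and sep: "L_separated L h k"
  shows "L_separated L (f ` h) (f ` k)"
proof -
  have iso': "dist (g x) (g y) = dist x y" for x y using iso[of "g x" "g y"] by (simp add: fg)
  have inj: "inj f" using gf by (rule inj_on_inverseI)
  have "finite c \<and> card c \<le> L"
    if c: "chain c" and meets: "\<forall>m\<in>c. m \<inter> f ` h \<noteq> {} \<and> m \<inter> f ` k \<noteq> {}" for c
  proof -
    have m: "g ` m \<inter> S \<noteq> {}" if "m \<inter> f ` S \<noteq> {}" for m S
      using that gf by force
    have "chain ((`) g ` c)" using chain_isometry[of g f] iso' fg gf c by blast
    moreover have "\<forall>m\<in>(`) g ` c. m \<inter> h \<noteq> {} \<and> m \<inter> k \<noteq> {}"
      using meets m by (simp add: ball_simps)
    ultimately have "finite ((`) g ` c)" "card ((`) g ` c) \<le> L"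
      using sep by (simp_all add: L_separated_def)
    moreover have "inj_on ((`) g) c"
      using inj_on_subset[OF inj_image_isometry[of g f] subset_UNIV] iso' fg gf by blast
    ultimately show ?thesis
      using finite_imageD[of "(`) g" c] card_image[of "(`) g" c] by simp
  qed
  moreover have "f ` h \<inter> f ` k = {}"
    using sep image_Int[OF inj, of h k] by (simp add: L_separated_def)
  moreover have "is_curtain (f ` h)" "is_curtain (f ` k)"
    using sep is_curtain_isometry[of f g] iso fg gf by (simp_all add: L_separated_def)
  ultimately show ?thesis by (simp add: L_separated_def)
qed

lemma dist_L_isometry_cards:
  fixes f g :: "'a \<Rightarrow> 'a"
  assumes iso: "\<And>x y. dist (f x) (f y) = dist x y"
    and fg: "\<And>x. f (g x) = x" and gf: "\<And>x. g (f x) = x"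
  shows "{card c | c. L_chain L c \<and> chain_separates c {x} {y}} \<subseteq>
    {card c | c. L_chain L c \<and> chain_separates c {f x} {f y}}"
proof
  fix m assume "m \<in> {card c | c. L_chain L c \<and> chain_separates c {x} {y}}"
  then obtain c where c: "L_chain L c" "chain_separates c {x} {y}" "m = card c" by blast
  have "inj_on ((`) f) c"
    using inj_on_subset[OF inj_image_isometry[of f g] subset_UNIV] iso fg gf by blast
  then have "m = card ((`) f ` c)" using c(3) card_image by metis
  moreover have "chain ((`) f ` c)"
    using chain_isometry[of f g c] iso fg gf c(1) by (simp add: L_chain_def)
  moreover have "pairwise (L_separated L) ((`) f ` c)"
  proof (rule pairwise_imageI)
    fix h k assume "h \<in> c" "k \<in> c" "h \<noteq> k"
    then have "L_separated L h k"
      using c(1) by (auto simp: L_chain_def dest: pairwiseD)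
    then show "L_separated L (f ` h) (f ` k)" by (rule L_separated_isometry[OF iso fg gf])
  qed
  moreover have "chain_separates ((`) f ` c) {f x} {f y}"
    using c(2) separates_isometry[of f g _ "{x}" "{y}"] iso fg gf by (simp add: chain_separates_def)
  ultimately show "m \<in> {card c | c. L_chain L c \<and> chain_separates c {f x} {f y}}"
    unfolding L_chain_def by blast
qed

lemma dist_L_isometry:
  fixes f g :: "'a \<Rightarrow> 'a"
  assumes iso: "\<And>x y. dist (f x) (f y) = dist x y"
    and fg: "\<And>x. f (g x) = x" and gf: "\<And>x. g (f x) = x"
  shows "dist_L L (f x) (f y) = dist_L L x y"
proof -
  have iso': "dist (g x) (g y) = dist x y" for x y using iso[of "g x" "g y"] by (simp add: fg)
  have "{card c | c. L_chain L c \<and> chain_separates c {f x} {f y}} =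
    {card c | c. L_chain L c \<and> chain_separates c {x} {y}}"
    using dist_L_isometry_cards[of f g, OF iso fg gf, of L x y]
      dist_L_isometry_cards[of g f, OF iso' gf fg, of L "f x" "f y"] unfolding gf
    by (rule equalityI[rotated])
  moreover have "f x = f y \<longleftrightarrow> x = y" using gf[of x] gf[of y] by metis
  ultimately show ?thesis unfolding dist_L_def by simp
qed

section \<open>The curtain model\<close>

lemma
  fixes x y :: 'a
  assumes w: "curtain_weights w"
  shows summable_curtain_dist: "summable (\<lambda>n. w (Suc n) * real (dist_L (Suc n) x y))"
    and curtain_dist_tail_le: "(\<Sum>n. w (Suc (n + N)) * real (dist_L (Suc (n + N)) x y)) \<le>
      (\<Sum>n. w (Suc (n + N))) * (2 * dist x y + 2)"
proof -
  have sw: "summable (\<lambda>n. w (Suc n) * (2 * dist x y + 2))"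
    using curtain_weightsD(2)[OF w] by (rule summable_mult2)
  have le: "w (Suc n) * real (dist_L (Suc n) x y) \<le> w (Suc n) * (2 * dist x y + 2)" for n
    using dist_L_le curtain_weightsD(1)[OF w, of n] by (intro mult_left_mono) auto
  have nn: "0 \<le> w (Suc n) * real (dist_L (Suc n) x y)" for n
    using curtain_weightsD(1)[OF w, of n] by simp
  show s: "summable (\<lambda>n. w (Suc n) * real (dist_L (Suc n) x y))"
    by (rule summable_comparison_test'[OF sw, of 0]) (use le nn in auto)
  have "(\<Sum>n. w (Suc (n + N)) * real (dist_L (Suc (n + N)) x y)) \<le>
      (\<Sum>n. w (Suc (n + N)) * (2 * dist x y + 2))"
    using le summable_ignore_initial_segment[OF s, of N] summable_ignore_initial_segment[OF sw, of N]
    by (intro suminf_le) auto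
  also have "\<dots> = (\<Sum>n. w (Suc (n + N))) * (2 * dist x y + 2)"
    using suminf_mult2[OF summable_ignore_initial_segment[OF curtain_weightsD(2)[OF w], of N]] by simp
  finally show "(\<Sum>n. w (Suc (n + N)) * real (dist_L (Suc (n + N)) x y)) \<le>
      (\<Sum>n. w (Suc (n + N))) * (2 * dist x y + 2)" .
qed

text \<open>Unboundedness of the curtain model is expressed in the theory of metric spaces on a carrier, which
  requires the metric axioms.\<close>

lemma Metric_space_curtain_dist:
  assumes w: "curtain_weights w"
  shows "Metric_space (UNIV :: 'a set) (curtain_dist w)"
proof
  fix x y z :: 'a
  let ?D = "\<lambda>x y n. w (Suc n) * real (dist_L (Suc n) x y)"
  note s = summable_curtain_dist[OF w]
  have nn: "0 \<le> ?D x y n" for x y :: 'a and n using curtain_weightsD(1)[OF w, of n] by simp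
  show "0 \<le> curtain_dist w x y"
    unfolding curtain_dist_def using nn by (intro suminf_nonneg[OF s]) auto
  show "curtain_dist w x y = curtain_dist w y x"
    by (simp only: curtain_dist_def dist_L_commute[of _ x y])
  show "curtain_dist w x y = 0 \<longleftrightarrow> x = y"
  proof
    assume "curtain_dist w x y = 0"
    then have "?D x y 0 = 0"
      using suminf_eq_zero_iff[OF s[of x y]] nn by (simp add: curtain_dist_def)
    then have "dist_L 1 x y = 0" using curtain_weightsD(1)[OF w, of 0] by simp
    then show "x = y" by (simp add: dist_L_def split: if_splits)
  qed (simp add: curtain_dist_def dist_L_def)
  have "?D x z n \<le> ?D x y n + ?D y z n" for n
  proof -
    have "real (dist_L (Suc n) x z) \<le> real (dist_L (Suc n) x y) + real (dist_L (Suc n) y z)"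
      using dist_L_triangle[of "Suc n" x z y] by linarith
    from mult_left_mono[OF this, of "w (Suc n)"] show ?thesis
      using curtain_weightsD(1)[OF w, of n] by (simp add: distrib_left)
  qed
  then show "curtain_dist w x z \<le> curtain_dist w x y + curtain_dist w y z"
    unfolding curtain_dist_def suminf_add[OF s[of x y] s[of y z]]
    by (intro suminf_le s summable_add)
qed

lemma curtain_dist_le:
  fixes x y :: 'a
  assumes "curtain_weights w"
  shows "curtain_dist w x y \<le> (\<Sum>n. w (Suc n)) * (2 * dist x y + 2)"
  using curtain_dist_tail_le[OF assms, of 0 x y] by (simp add: curtain_dist_def)

text \<open>Otherwise every term with \<open>n < N\<close> of the series of \<open>D(a,b)\<close> is at most the corresponding term of
  \<open>D(a,x) + D(b,y) + 5 W\<close>, and the remaining terms add less than 1. The bound \<open>N\<close> on the scale depends on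
  \<open>d(a,b)\<close> and the weights only, which makes the final estimate uniform over all translates of a pair.\<close>

lemma scale_with_surviving_L_distance:
  fixes a b x y :: 'a
  assumes w: "curtain_weights w"
    and tail: "(\<Sum>n. w (Suc (n + N))) * (2 * dist a b + 2) < 1"
    and big: "curtain_dist w a x + curtain_dist w b y + 5 * (\<Sum>n. w (Suc n)) + 1 \<le> curtain_dist w a b"
  shows "\<exists>L\<le>N. dist_L L a x + dist_L L b y + 5 \<le> dist_L L a b"
proof (rule ccontr)
  assume no: "\<not> ?thesis"
  let ?D = "\<lambda>x y n. w (Suc n) * real (dist_L (Suc n) x y)"
  let ?E = "\<lambda>n. ?D a x n + ?D b y n + 5 * w (Suc n)"
  note s = summable_curtain_dist[OF w]
  have sE: "summable ?E"
    using s[of a x] s[of b y] curtain_weightsD(2)[OF w] by (intro summable_add summable_mult)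
  have E: "suminf ?E = curtain_dist w a x + curtain_dist w b y + 5 * (\<Sum>n. w (Suc n))"
    unfolding curtain_dist_def
    using suminf_add[OF summable_add[OF s[of a x] s[of b y]] summable_mult[OF curtain_weightsD(2)[OF w], of 5]]
      suminf_add[OF s[of a x] s[of b y]] suminf_mult[OF curtain_weightsD(2)[OF w], of 5] by simp
  have "?D a b n \<le> ?E n" if "n < N" for n
  proof -
    have "\<not> dist_L (Suc n) a x + dist_L (Suc n) b y + 5 \<le> dist_L (Suc n) a b"
      using no Suc_leI[OF that] by blast
    then have "real (dist_L (Suc n) a b) \<le> real (dist_L (Suc n) a x) + real (dist_L (Suc n) b y) + 5"
      by linarith
    then have "?D a b n \<le> w (Suc n) * (real (dist_L (Suc n) a x) + real (dist_L (Suc n) b y) + 5)"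
      using curtain_weightsD(1)[OF w, of n] by (intro mult_left_mono) auto
    then show ?thesis by (simp add: algebra_simps)
  qed
  then have "(\<Sum>n<N. ?D a b n) \<le> (\<Sum>n<N. ?E n)" by (intro sum_mono) simp
  also have "\<dots> \<le> suminf ?E"
  proof (rule sum_le_suminf[OF sE])
    show "0 \<le> ?E n" for n
      using curtain_weightsD(1)[OF w, of n] by (intro add_nonneg_nonneg mult_nonneg_nonneg) auto
  qed simp
  finally have "curtain_dist w a b < suminf ?E + 1"
    using suminf_split_initial_segment[OF s[of a b], of N] curtain_dist_tail_le[OF w, of N a b] tail
    unfolding curtain_dist_def by linarith
  then show False using E big by linarith
qed

end

section \<open>Equality of the coarse kernels\<close>

theorem theorem1p5:
  fixes G :: "('g, 'm) monoid_scheme"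
    and \<phi> :: "'g \<Rightarrow> 'a::metric_space \<Rightarrow> 'a"
    and w :: "nat \<Rightarrow> real"
  assumes weights: "curtain_weights w"
    and proper: "\<And>(x::'a) r. compact (cball x r)"
    and CAT0: "CAT0 TYPE('a)"
    and unbounded: "\<not> Metric_space.mbounded (UNIV :: 'a set) (curtain_dist w) UNIV"
    and action: "isometric_action G \<phi>"
    and cocompact: "cocompact_action G \<phi>"
  shows "coarse_kernel G \<phi> dist = coarse_kernel G \<phi> (curtain_dist w)"
proof
  define W where "W = (\<Sum>n. w (Suc n))"
  have W: "0 \<le> W"
    unfolding W_def using curtain_weightsD[OF weights] by (intro suminf_nonneg) (auto intro: less_imp_le)
  show "coarse_kernel G \<phi> dist \<subseteq> coarse_kernel G \<phi> (curtain_dist w)"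
  proof
    fix g assume "g \<in> coarse_kernel G \<phi> dist"
    then obtain C where g: "g \<in> carrier G" and C: "C > 0" "\<And>z. dist (\<phi> g z) z \<le> C"
      by (auto simp: coarse_kernel_def)
    have "curtain_dist w (\<phi> g z) z \<le> W * (2 * C + 2) + 1" for z
    proof -
      have "curtain_dist w (\<phi> g z) z \<le> W * (2 * dist (\<phi> g z) z + 2)"
        unfolding W_def by (rule curtain_dist_le[OF CAT0 weights])
      also have "\<dots> \<le> W * (2 * C + 2)" using W C(2)[of z] by (intro mult_left_mono) auto
      finally show ?thesis by simp
    qed
    moreover have "W * (2 * C + 2) + 1 > 0" using W C(1) by (intro add_nonneg_pos mult_nonneg_nonneg) auto
    ultimately show "g \<in> coarse_kernel G \<phi> (curtain_dist w)"
      using g unfolding coarse_kernel_def by blast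
  qed
  show "coarse_kernel G \<phi> (curtain_dist w) \<subseteq> coarse_kernel G \<phi> dist"
  proof
    fix g assume "g \<in> coarse_kernel G \<phi> (curtain_dist w)"
    then obtain C where g: "g \<in> carrier G" and C: "\<And>z. curtain_dist w (\<phi> g z) z \<le> C"
      by (auto simp: coarse_kernel_def)
    interpret D: Metric_space "UNIV :: 'a set" "curtain_dist w"
      using Metric_space_curtain_dist[OF CAT0 weights] .
    interpret group_action G UNIV \<phi> using action by (simp add: isometric_action_def)
    have iso: "dist (\<phi> h x) (\<phi> h y) = dist x y" if "h \<in> carrier G" for h x y
      using action that by (simp add: isometric_action_def)
    have bij: "bij (\<phi> h)" if "h \<in> carrier G" for h
      using bij_prop0[OF that] by (simp add: Bij_def)
    have dL: "dist_L L (\<phi> h x) (\<phi> h y) = dist_L L x y" if "h \<in> carrier G" for h L x y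
      using dist_L_isometry[OF CAT0, of "\<phi> h" "inv_into UNIV (\<phi> h)"] iso[OF that]
        surj_f_inv_f[OF bij_is_surj[OF bij[OF that]]] inv_f_f[OF bij_is_inj[OF bij[OF that]]] by simp
    have D_inv: "curtain_dist w (\<phi> h x) (\<phi> h y) = curtain_dist w x y" if "h \<in> carrier G" for h x y
      unfolding curtain_dist_def dL[OF that] ..
    \<comment> \<open>Any point may serve as the base point.\<close>
    define a :: 'a where "a = undefined"
    obtain b where b: "2 * C + 5 * W + 1 < curtain_dist w a b"
    proof (rule ccontr)
      assume "\<not> thesis"
      then have "curtain_dist w a b \<le> 2 * C + 5 * W + 1" for b using that[of b] by linarith
      then have "UNIV \<subseteq> D.mcball a (2 * C + 5 * W + 1)" by auto
      then have "D.mbounded UNIV" unfolding D.mbounded_def by blast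
      then show False using unbounded by simp
    qed
    define M where "M = dist a b"
    obtain N where N: "(\<Sum>n. w (Suc (n + N))) * (2 * M + 2) < 1"
    proof -
      have pos: "0 < 2 * M + 2" by (simp add: M_def add_nonneg_pos)
      obtain N where "norm (\<Sum>n. w (Suc (n + N))) < 1 / (2 * M + 2)"
        using suminf_exist_split[OF _ curtain_weightsD(2)[OF weights], of "1 / (2 * M + 2)"] pos by auto
      then have "(\<Sum>n. w (Suc (n + N))) < 1 / (2 * M + 2)" by simp
      then show ?thesis using that[of N] pos by (simp add: pos_less_divide_eq)
    qed
    have near_a: "dist (\<phi> h a) (\<phi> g (\<phi> h a)) \<le> 4 * M + 2 * real N + 3" if h: "h \<in> carrier G" for h
    proof -
      have M: "dist (\<phi> h a) (\<phi> h b) = M" using iso[OF h] by (simp add: M_def)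
      have "curtain_dist w (\<phi> h a) (\<phi> g (\<phi> h a)) \<le> C" "curtain_dist w (\<phi> h b) (\<phi> g (\<phi> h b)) \<le> C"
        using C[of "\<phi> h a"] C[of "\<phi> h b"] D.commute by metis+
      then have big: "curtain_dist w (\<phi> h a) (\<phi> g (\<phi> h a)) + curtain_dist w (\<phi> h b) (\<phi> g (\<phi> h b)) +
          5 * (\<Sum>n. w (Suc n)) + 1 \<le> curtain_dist w (\<phi> h a) (\<phi> h b)"
        unfolding D_inv[OF h, of a b] using b by (simp add: W_def)
      obtain L where L: "L \<le> N" "dist_L L (\<phi> h a) (\<phi> g (\<phi> h a)) + dist_L L (\<phi> h b) (\<phi> g (\<phi> h b)) + 5
          \<le> dist_L L (\<phi> h a) (\<phi> h b)"
        using scale_with_surviving_L_distance[OF CAT0 weights _ big, of N] N unfolding M by blast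
      have "dist (\<phi> h a) (\<phi> g (\<phi> h a)) \<le> 4 * dist (\<phi> h a) (\<phi> h b) + 2 * real L + 3"
        using dist_le_if_L_distance_survives[OF CAT0 L(2)] iso[OF g] by simp
      then show ?thesis using L(1) M by simp
    qed
    obtain K where K: "compact K" "(\<Union>h\<in>carrier G. \<phi> h ` K) = UNIV"
      using cocompact by (auto simp: cocompact_action_def)
    obtain R where R: "R > 0" "\<And>k. k \<in> K \<Longrightarrow> dist a k \<le> R"
      using compact_imp_bounded[OF K(1)] unfolding bounded_any_center[of K a]
      by (metis linorder_le_cases linorder_not_le order_trans zero_less_one)
    have "dist (\<phi> g z) z \<le> 2 * R + (4 * M + 2 * real N + 3)" for z
    proof -
      obtain h k where h: "h \<in> carrier G" and k: "k \<in> K" and z: "z = \<phi> h k"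
        using K(2) by blast
      have "dist z (\<phi> h a) = dist a k" using iso[OF h] z by (simp add: dist_commute)
      then show ?thesis
        using R(2)[OF k] near_a[OF h] iso[OF g, of z "\<phi> h a"]
          dist_triangle[of "\<phi> g z" z "\<phi> g (\<phi> h a)"] dist_triangle[of "\<phi> g (\<phi> h a)" z "\<phi> h a"]
          dist_commute[of z "\<phi> h a"] dist_commute[of "\<phi> h a" "\<phi> g (\<phi> h a)"] by linarith
    qed
    moreover have "2 * R + (4 * M + 2 * real N + 3) > 0"
      using R(1) zero_le_dist[of a b] by (simp add: M_def add_pos_nonneg)
    ultimately show "g \<in> coarse_kernel G \<phi> dist"
      using g unfolding coarse_kernel_def by blast
  qed
qed

end
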